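(* Fix an integer $p \ge 2$ and consider the order-$p$ spiked tensor model with the Rademacher prior: under $\mathbb{P}_n$ one observes $Y = \lambda x^{\otimes p} + Z$ and under $\mathbb{Q}_n$ one observes $Y = Z$, where $x \in \mathbb{R}^n$ has i.i.d. entries $x_i \sim \mathrm{Unif}(\{\pm 1\})$ and $Z \in (\mathbb{R}^n)^{\otimes p}$ is independent of $x$ with i.i.d. $\mathcal{N}(0,1)$ entries. Fix sequences $D = D(n)$ (positive integers) and $\lambda = \lambda(n) > 0$. There are constants $0 < A_p < B_p$ depending only on $p$ (concretely, one may take $A_p = \frac{1}{\sqrt{2}} p^{-p/4-1/2}$ and $B_p = \sqrt{2}\, e^{p/2} p^{-p/4}$) such that the following hold. (i) If $\lambda \le A_p\, n^{-p/4} D^{(2-p)/4}$ for all sufficiently large $n$, then $\|L_n^{\le D}\| = O(1)$. (ii) If $\lambda \ge B_p\, n^{-p/4} D^{(2-p)/4}$ and $D \le \frac{2}{p} n$ for all sufficiently large $n$, and $D = \omega(1)$, then $\|L_n^{\le D}\| = \omega(1)$. Here the limit is $n \to \infty$ with $p$ held fixed, so $O(1)$ and $\omega(1)$ may hide constants depending on $p$.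
   Context: For $x \in \mathbb{R}^n$, $x^{\otimes p} \in (\mathbb{R}^n)^{\otimes p} \cong \mathbb{R}^{n^p}$ is the tensor with entries $(x^{\otimes p})_{i_1,\dots,i_p} = x_{i_1}\cdots x_{i_p}$. The likelihood ratio is $L_n = d\mathbb{P}_n/d\mathbb{Q}_n$. On $L^2(\mathbb{Q}_n)$ use the inner product $\langle f,g\rangle = \mathbb{E}_{Y\sim\mathbb{Q}_n}[f(Y)g(Y)]$ and norm $\|f\| = \sqrt{\langle f,f\rangle}$. The $D$-low-degree likelihood ratio $L_n^{\le D}$ is the orthogonal projection in $L^2(\mathbb{Q}_n)$ of $L_n$ onto the linear subspace of polynomials in the entries of $Y$ of (total) degree at most $D$. $O(1)$ means bounded as $n\to\infty$; $\omega(1)$ means tending to infinity as $n\to\infty$. *)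

theory Defs
  imports "HOL-Probability.Probability" "HOL-Library.Landau_Symbols"
begin

text \<open>
  An order-\<open>p\<close> tensor over \<open>\<real>\<^sup>n\<close> is a real-valued function on the multi-indices
  \<open>(i\<^sub>1, \<dots>, i\<^sub>p)\<close>; both tensor positions and coordinates are counted from \<open>0\<close>.
\<close>

definition tensor_index :: "nat \<Rightarrow> nat \<Rightarrow> (nat \<Rightarrow> nat) set" where
  "tensor_index p n = {..<p} \<rightarrow>\<^sub>E {..<n}"

definition tensor_power :: "nat \<Rightarrow> (nat \<Rightarrow> real) \<Rightarrow> (nat \<Rightarrow> nat) \<Rightarrow> real" where
  "tensor_power p x = (\<lambda>i. \<Prod>j<p. x (i j))"

definition rademacher_prior :: "nat \<Rightarrow> (nat \<Rightarrow> real) pmf" where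
  "rademacher_prior n = Pi_pmf {..<n} 0 (\<lambda>_. pmf_of_set {-1, 1})"

definition null_measure :: "nat \<Rightarrow> nat \<Rightarrow> ((nat \<Rightarrow> nat) \<Rightarrow> real) measure" where
  "null_measure p n = PiM (tensor_index p n) (\<lambda>_. std_normal_distribution)"

definition planted_measure :: "nat \<Rightarrow> nat \<Rightarrow> real \<Rightarrow> ((nat \<Rightarrow> nat) \<Rightarrow> real) measure" where
  "planted_measure p n lam =
     distr (measure_pmf (rademacher_prior n) \<Otimes>\<^sub>M null_measure p n)
       (PiM (tensor_index p n) (\<lambda>_. borel))
       (\<lambda>(x, Z). \<lambda>i\<in>tensor_index p n. lam * tensor_power p x i + Z i)"

definition likelihood_ratio :: "nat \<Rightarrow> nat \<Rightarrow> real \<Rightarrow> ((nat \<Rightarrow> nat) \<Rightarrow> real) \<Rightarrow> real" where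
  "likelihood_ratio p n lam =
     (\<lambda>Y. enn2real (RN_deriv (null_measure p n) (planted_measure p n lam) Y))"

definition L2_inner :: "'a measure \<Rightarrow> ('a \<Rightarrow> real) \<Rightarrow> ('a \<Rightarrow> real) \<Rightarrow> real" where
  "L2_inner M f g = (\<integral>Y. f Y * g Y \<partial>M)"

definition L2_norm :: "'a measure \<Rightarrow> ('a \<Rightarrow> real) \<Rightarrow> real" where
  "L2_norm M f = sqrt (L2_inner M f f)"

text \<open>
  Orthogonal projection of a square-integrable \<open>f\<close> onto a subspace \<open>V\<close> of \<open>L\<^sup>2(M)\<close>.
  Elements of \<open>L\<^sup>2(M)\<close> are represented by functions, so the projection is determined
  only almost everywhere; the choice made here does not affect inner products or norms.
  A projection exists whenever \<open>V\<close> is finite-dimensional.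
\<close>

definition L2_projection :: "'a measure \<Rightarrow> ('a \<Rightarrow> real) set \<Rightarrow> ('a \<Rightarrow> real) \<Rightarrow> 'a \<Rightarrow> real" where
  "L2_projection M V f =
     (SOME g. g \<in> V \<and> (\<forall>h\<in>V. L2_inner M (\<lambda>Y. f Y - g Y) h = 0))"

text \<open>
  Exponent vectors of the monomials of total degree at most \<open>D\<close> in the variables indexed
  by \<open>I\<close>. Bounding each exponent by \<open>D\<close> is no restriction; it makes the set visibly finite
  for finite \<open>I\<close>.
\<close>

definition exponents_upto :: "'i set \<Rightarrow> nat \<Rightarrow> ('i \<Rightarrow> nat) set" where
  "exponents_upto I D = {\<alpha> \<in> I \<rightarrow>\<^sub>E {..D}. (\<Sum>i\<in>I. \<alpha> i) \<le> D}"

definition polynomials_upto :: "'i set \<Rightarrow> nat \<Rightarrow> (('i \<Rightarrow> real) \<Rightarrow> real) set" where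
  "polynomials_upto I D =
     {f. \<exists>c. f = (\<lambda>Y. \<Sum>\<alpha>\<in>exponents_upto I D. c \<alpha> * (\<Prod>i\<in>I. Y i ^ \<alpha> i))}"

definition low_degree_likelihood_ratio ::
    "nat \<Rightarrow> nat \<Rightarrow> real \<Rightarrow> nat \<Rightarrow> ((nat \<Rightarrow> nat) \<Rightarrow> real) \<Rightarrow> real" where
  "low_degree_likelihood_ratio p n lam D =
     L2_projection (null_measure p n) (polynomials_upto (tensor_index p n) D)
       (likelihood_ratio p n lam)"

definition low_degree_norm :: "nat \<Rightarrow> nat \<Rightarrow> real \<Rightarrow> nat \<Rightarrow> real" where
  "low_degree_norm p n lam D =
     L2_norm (null_measure p n) (low_degree_likelihood_ratio p n lam D)"

definition lower_const :: "nat \<Rightarrow> real" where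
  "lower_const p = 1 / sqrt 2 * real p powr (- real p / 4 - 1 / 2)"

definition upper_const :: "nat \<Rightarrow> real" where
  "upper_const p = sqrt 2 * exp (real p / 2) * real p powr (- real p / 4)"

end

theory Submission
  imports Defs "HOL-Computational_Algebra.Polynomial"
begin

text \<open>
  Everything rests on an exact formula (\<open>low_degree_norm_sq\<close>): with \<open>S\<^sub>n\<close> a sum of
  \<open>n\<close> independent random signs, the squared low-degree norm is the sum over \<open>d \<le> D\<close> of
  \<open>\<lambda>\<^bsup>2d\<^esup> / d!\<close> times the moment of \<open>S\<^sub>n\<close> of order \<open>p d\<close>.

  The formula comes from a statement about every additive Gaussian model \<open>Y = u(x) + Z\<close>
  whose prior has finite support (\<open>additive_gaussian_low_degree_norm\<close>). Products of
  Hermite polynomials of total degree at most \<open>D\<close> are orthogonal, and the mean of a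
  monomial under a shifted Gaussian expands in them with coefficients
  \<open>u\<^sup>\<alpha> / \<alpha>!\<close>. The Hermite expansion with coefficients \<open>E[u(x)\<^sup>\<alpha>] / \<alpha>!\<close> therefore has
  the same inner products with all polynomials as the likelihood ratio: it is the
  projection. Writing the square of an expectation over \<open>x\<close> as an expectation over two
  independent copies \<open>x, x'\<close> turns the squared norm into the mean of the exponential
  series of \<open>\<langle>u(x), u(x')\<rangle>\<close> cut off after degree \<open>D\<close>. For a tensor power this inner
  product is \<open>\<lambda>\<^sup>2 \<langle>x, x'\<rangle>\<^sup>p\<close>, and \<open>\<langle>x, x'\<rangle>\<close> has the law of \<open>S\<^sub>n\<close>.

  Odd moments of \<open>S\<^sub>n\<close> vanish. Its moment of order \<open>2k\<close> is at most the Gaussian one, hence at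
  most \<open>(n k)\<^sup>k\<close> (\<open>sign_sum_moment_upper\<close>), and for \<open>k \<le> n\<close> it is at least
  \<open>(2 n k / e\<^sup>2)\<^sup>k\<close>, by counting the words in which \<open>k\<close> letters occur twice each
  (\<open>sign_sum_moment_lower\<close>). Below the threshold the term of degree \<open>d\<close> is then at most
  \<open>(e/4)\<^sup>d\<close>, so the norm is bounded by the sum of a geometric series. Above it, the term of
  the largest even degree \<open>d \<le> D\<close> alone is of order at least \<open>2\<^sup>d\<close>; the condition
  \<open>D \<le> 2 n / p\<close> is what makes \<open>k = p d / 2\<close> at most \<open>n\<close> there.
\<close>

section \<open>Hermite polynomials under the standard Gaussian\<close>

text \<open>
  The probabilists' Hermite polynomials, monic and orthogonal under the standard Gaussian.
  The recursion is the one that integration by parts consumes.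
\<close>

fun hermite :: "nat \<Rightarrow> real poly" where
  "hermite 0 = 1"
| "hermite (Suc n) = pCons 0 (hermite n) - pderiv (hermite n)"

lemma degree_hermite_le: "degree (hermite n) \<le> n"
proof (induction n)
  case (Suc n)
  have "degree (pCons 0 (hermite n)) \<le> Suc n"
    using Suc by (meson degree_pCons_le order_trans Suc_le_mono)
  moreover have "degree (pderiv (hermite n)) \<le> Suc n"
    using Suc by (simp add: degree_pderiv)
  ultimately show ?case by (simp add: degree_diff_le)
qed simp

lemma coeff_hermite_self: "coeff (hermite n) n = 1"
proof (induction n)
  case (Suc n)
  have "coeff (pderiv (hermite n)) (Suc n) = 0"
    by (simp add: coeff_pderiv coeff_eq_0 degree_hermite_le le_imp_less_Suc order_le_less_trans[of _ n])
  then show ?case using Suc by simp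
qed simp

lemma prob_space_std_normal: "prob_space std_normal_distribution"
  using real_dist_normal_dist by (simp add: real_distribution_def)

lemma integrable_poly_std_normal: "integrable std_normal_distribution (poly q)"
proof -
  have "integrable std_normal_distribution (\<lambda>x. \<Sum>i\<le>degree q. coeff q i * x ^ i)"
    by (intro Bochner_Integration.integrable_sum integrable_mult_right integrable_std_normal_distribution_moment)
  then show ?thesis by (simp add: poly_altdef[abs_def])
qed

lemma integrable_std_normal_if_poly:
  assumes "\<And>z. f z = poly q z"
  shows "integrable std_normal_distribution f"
  using integrable_poly_std_normal[of q] assms by (simp cong: Bochner_Integration.integrable_cong)

lemma integrable_poly_mult_std_normal: "integrable std_normal_distribution (\<lambda>z. poly p z * poly q z)"
  by (rule integrable_std_normal_if_poly[where q = "p * q"]) simp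

lemma gaussian_moment_rec:
  "(\<integral>z. z ^ Suc (Suc k) \<partial>std_normal_distribution) =
     real (Suc k) * (\<integral>z. z ^ k \<partial>std_normal_distribution)"
proof (cases "even k")
  case True
  then obtain j where k: "k = 2 * j" by (elim evenE)
  have "(\<integral>z. z ^ Suc (Suc k) \<partial>std_normal_distribution) = fact (2 * Suc j) / (2 ^ Suc j * fact (Suc j))"
    using std_normal_distribution_even_moments(1)[of "Suc j"] by (simp add: k)
  also have "\<dots> = (2 * real j + 1) * (fact (2 * j) / (2 ^ j * fact j))"
  proof -
    have "fact (2 * Suc j) = (2 * (1 + real j)) * (2 * real j + 1) * fact (2 * j)"
      by (simp add: algebra_simps)
    moreover have "2 ^ Suc j * fact (Suc j) = (2 * (1 + real j)) * (2 ^ j * fact j)"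
      by (simp add: algebra_simps)
    moreover have "2 * (1 + real j) \<noteq> 0"
      by simp
    ultimately show ?thesis
      by (simp only: mult.assoc mult_divide_mult_cancel_left times_divide_eq_right)
  qed
  also have "\<dots> = real (Suc k) * (\<integral>z. z ^ k \<partial>std_normal_distribution)"
    using std_normal_distribution_even_moments(1)[of j] by (simp add: k)
  finally show ?thesis .
next
  case False
  then have "odd (Suc (Suc k))"
    by simp
  then show ?thesis
    using False integral_std_normal_distribution_moment_odd[of "Suc (Suc k)"]
      integral_std_normal_distribution_moment_odd[of k] by (metis mult_zero_right)
qed

text \<open>
  Both sides are linear in the polynomial, so this is the recursion for Gaussian moments
  read off on monomials; no boundary terms have to be discussed.
\<close>

lemma gaussian_integration_by_parts:
  "(\<integral>z. poly (pCons 0 q) z \<partial>std_normal_distribution) = (\<integral>z. poly (pderiv q) z \<partial>std_normal_distribution)"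
proof -
  have mono: "(\<integral>z. z * z ^ i \<partial>std_normal_distribution) =
      (\<integral>z. poly (pderiv (monom 1 i)) z \<partial>std_normal_distribution)" for i
  proof (cases i)
    case 0
    then show ?thesis using integral_std_normal_distribution_moment_odd[of 1] by (simp add: monom_0)
  next
    case (Suc j)
    then show ?thesis
      using gaussian_moment_rec[of j] by (simp add: pderiv_monom poly_monom)
  qed
  have "(\<integral>z. poly (pCons 0 q) z \<partial>std_normal_distribution) =
      (\<integral>z. (\<Sum>i\<le>degree q. coeff q i * (z * z ^ i)) \<partial>std_normal_distribution)"
    by (simp add: poly_altdef[of q] sum_distrib_left mult_ac)
  also have "\<dots> = (\<Sum>i\<le>degree q. coeff q i * (\<integral>z. z * z ^ i \<partial>std_normal_distribution))"
    using integrable_std_normal_distribution_moment[of "Suc _"]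
    by (subst Bochner_Integration.integral_sum) auto
  also have "\<dots> = (\<Sum>i\<le>degree q. coeff q i * (\<integral>z. poly (pderiv (monom 1 i)) z \<partial>std_normal_distribution))"
    by (simp only: mono)
  also have "\<dots> = (\<integral>z. (\<Sum>i\<le>degree q. coeff q i * poly (pderiv (monom 1 i)) z) \<partial>std_normal_distribution)"
    by (subst Bochner_Integration.integral_sum) (auto intro: integrable_poly_std_normal)
  also have "(\<lambda>z. \<Sum>i\<le>degree q. coeff q i * poly (pderiv (monom 1 i)) z) = poly (pderiv q)"
  proof
    fix z
    have "q = (\<Sum>i\<le>degree q. smult (coeff q i) (monom 1 i))"
      by (simp add: poly_as_sum_of_monoms smult_monom)
    then have "pderiv q = pderiv (\<Sum>i\<le>degree q. smult (coeff q i) (monom 1 i))"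
      by (rule arg_cong)
    also have "\<dots> = (\<Sum>i\<le>degree q. smult (coeff q i) (pderiv (monom 1 i)))"
      using higher_pderiv_sum[of 1 "\<lambda>i. smult (coeff q i) (monom 1 i)" "{..degree q}"]
      by (simp only: funpow.simps One_nat_def o_apply id_apply pderiv_smult)
    finally have "pderiv q = (\<Sum>i\<le>degree q. smult (coeff q i) (pderiv (monom 1 i)))" .
    then show "(\<Sum>i\<le>degree q. coeff q i * poly (pderiv (monom 1 i)) z) = poly (pderiv q) z"
      by (simp add: poly_sum)
  qed
  finally show ?thesis .
qed

text \<open>
  Each step of the Hermite recursion moves one derivative onto the other factor: in
  \<open>z H q - H' q\<close> integration by parts replaces \<open>z H q\<close> by \<open>(H q)'\<close>.
\<close>

lemma gaussian_mean_hermite_mult: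
  "(\<integral>z. poly (hermite a) z * poly q z \<partial>std_normal_distribution) =
     (\<integral>z. poly ((pderiv ^^ a) q) z \<partial>std_normal_distribution)"
proof (induction a arbitrary: q)
  case (Suc a)
  let ?N = std_normal_distribution
  have "(\<integral>z. poly (hermite (Suc a)) z * poly q z \<partial>?N) =
      (\<integral>z. poly (pCons 0 (hermite a * q)) z - poly (pderiv (hermite a) * q) z \<partial>?N)"
    by (simp add: algebra_simps)
  also have "\<dots> = (\<integral>z. poly (pderiv (hermite a * q)) z \<partial>?N) - (\<integral>z. poly (pderiv (hermite a) * q) z \<partial>?N)"
    by (subst Bochner_Integration.integral_diff)
      (simp_all only: integrable_poly_std_normal gaussian_integration_by_parts)
  also have "\<dots> = (\<integral>z. poly (pderiv (hermite a * q)) z - poly (pderiv (hermite a) * q) z \<partial>?N)"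
    by (subst Bochner_Integration.integral_diff) (simp_all only: integrable_poly_std_normal)
  also have "\<dots> = (\<integral>z. poly (hermite a) z * poly (pderiv q) z \<partial>?N)"
    by (simp add: pderiv_mult algebra_simps)
  also have "\<dots> = (\<integral>z. poly ((pderiv ^^ Suc a) q) z \<partial>?N)"
    by (simp only: Suc funpow_Suc_right o_apply)
  finally show ?case .
qed simp

lemma higher_pderiv_of_degree_le:
  fixes q :: "real poly"
  assumes "degree q \<le> a"
  shows "(pderiv ^^ a) q = [:fact a * coeff q a:]"
proof (rule poly_eqI)
  fix n
  show "coeff ((pderiv ^^ a) q) n = coeff [:fact a * coeff q a:] n"
    using assms by (cases n) (auto simp: coeff_higher_pderiv coeff_eq_0 pochhammer_fact)
qed

text \<open>
  Moving all derivatives onto the factor of smaller degree kills it; for equal degrees the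
  derivative of the monic factor is the constant \<open>a!\<close>.
\<close>

lemma hermite_orthogonal:
  "(\<integral>z. poly (hermite a) z * poly (hermite b) z \<partial>std_normal_distribution) = (if a = b then fact a else 0)"
proof -
  have le: "(\<integral>z. poly (hermite a) z * poly (hermite b) z \<partial>std_normal_distribution) = (if a = b then fact a else 0)"
    if "b \<le> a" for a b
  proof -
    interpret prob_space std_normal_distribution by (rule prob_space_std_normal)
    have "coeff (hermite b) a = (if a = b then 1 else 0)"
      using that coeff_eq_0[of "hermite b" a] degree_hermite_le[of b]
      by (auto simp: coeff_hermite_self)
    moreover have "degree (hermite b) \<le> a"
      using that degree_hermite_le[of b] by linarith
    ultimately show ?thesis
      using prob_space by (simp add: gaussian_mean_hermite_mult higher_pderiv_of_degree_le)
  qed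
  show ?thesis
    using le[of a b] le[of b a] by (cases "b \<le> a") (auto simp: mult.commute)
qed

lemma higher_pderiv_monom_binomial:
  assumes "a \<le> b"
  shows "(pderiv ^^ a) (monom (1::real) b) = monom (fact a * of_nat (b choose a)) (b - a)"
  using assms
proof (induction a)
  case (Suc a)
  have "real (b - a) * (fact a * real (b choose a)) = fact (Suc a) * real (b choose Suc a)"
  proof -
    have "Suc a * (b choose Suc a) = (b choose a) * (b - a)"
      using Suc.prems by (metis binomial_absorption binomial_absorb_comp mult.commute)
    then have "real (Suc a) * real (b choose Suc a) = real (b choose a) * real (b - a)"
      by (metis of_nat_mult)
    then show ?thesis by (simp only: fact_Suc of_nat_mult) (simp add: mult_ac)
  qed
  then show ?case using Suc by (simp add: pderiv_monom del: fact_Suc)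
qed simp

text \<open>
  Taylor's formula in \<open>u\<close>, averaged over \<open>z\<close>: the \<open>a\<close>-th derivative of the power has the
  same mean as its product with the Hermite polynomial of degree \<open>a\<close>. This is how the
  moments of a planted observation become inner products under the null model.
\<close>

lemma gaussian_mean_shifted_power:
  "(\<integral>z. (u + z) ^ b \<partial>std_normal_distribution) =
     (\<Sum>a\<le>b. u ^ a / fact a * (\<integral>z. poly (hermite a) z * z ^ b \<partial>std_normal_distribution))"
proof -
  have "(\<integral>z. poly (hermite a) z * z ^ b \<partial>std_normal_distribution) =
      (\<integral>z. fact a * real (b choose a) * z ^ (b - a) \<partial>std_normal_distribution)" if "a \<le> b" for a
    using gaussian_mean_hermite_mult[of a "monom 1 b"] higher_pderiv_monom_binomial[OF that]
    by (simp add: poly_monom)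
  then have "(\<Sum>a\<le>b. u ^ a / fact a * (\<integral>z. poly (hermite a) z * z ^ b \<partial>std_normal_distribution)) =
      (\<Sum>a\<le>b. real (b choose a) * u ^ a * (\<integral>z. z ^ (b - a) \<partial>std_normal_distribution))"
    by (intro sum.cong) auto
  also have "\<dots> = (\<integral>z. (\<Sum>a\<le>b. real (b choose a) * u ^ a * z ^ (b - a)) \<partial>std_normal_distribution)"
    by (subst Bochner_Integration.integral_sum) (auto intro: integrable_std_normal_distribution_moment)
  also have "\<dots> = (\<integral>z. (u + z) ^ b \<partial>std_normal_distribution)"
    by (simp add: binomial_ring)
  finally show ?thesis ..
qed

lemma gaussian_mean_hermite_power_eq_0:
  assumes "b < a"
  shows "(\<integral>z. poly (hermite a) z * z ^ b \<partial>std_normal_distribution) = 0"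
  using gaussian_mean_hermite_mult[of a "monom 1 b"] assms
  by (simp add: poly_monom higher_pderiv_of_degree_le degree_monom_eq)

section \<open>Norms of orthogonal projections\<close>

text \<open>
  Two projections of the same element may differ as functions, but each has the inner
  products of \<open>f\<close> with all of \<open>V\<close>, in particular with the other one, so their norms agree.
  This frees the computation from the particular choice made by \<open>L2_projection\<close>.
\<close>

lemma L2_norm_projection:
  assumes g: "g \<in> V" and proj: "\<And>h. h \<in> V \<Longrightarrow> L2_inner M g h = L2_inner M f h"
    and int_f: "\<And>h. h \<in> V \<Longrightarrow> integrable M (\<lambda>Y. f Y * h Y)"
    and int_V: "\<And>h h'. h \<in> V \<Longrightarrow> h' \<in> V \<Longrightarrow> integrable M (\<lambda>Y. h Y * h' Y)"
  shows "L2_norm M (L2_projection M V f) = L2_norm M g"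
proof -
  have residual: "L2_inner M (\<lambda>Y. f Y - k Y) h = L2_inner M f h - L2_inner M k h"
    if "k \<in> V" "h \<in> V" for k h
    unfolding L2_inner_def left_diff_distrib
    using that by (intro Bochner_Integration.integral_diff int_f int_V)
  define k where "k = L2_projection M V f"
  have "k \<in> V \<and> (\<forall>h\<in>V. L2_inner M (\<lambda>Y. f Y - k Y) h = 0)"
    unfolding k_def L2_projection_def
    \<comment> \<open>\<open>g\<close> witnesses that a projection exists\<close>
    by (rule someI[where x = g]) (use g proj residual in auto)
  then have k: "k \<in> V" "\<And>h. h \<in> V \<Longrightarrow> L2_inner M k h = L2_inner M f h"
    using residual by auto
  have comm: "L2_inner M a b = L2_inner M b a" for a b
    by (simp add: L2_inner_def mult.commute)
  have "L2_inner M k k = L2_inner M g k"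
    using k proj by simp
  also have "\<dots> = L2_inner M g g"
    using comm[of g k] k proj g by simp
  finally show ?thesis
    by (simp add: L2_norm_def k_def)
qed

section \<open>Polynomials of bounded total degree\<close>

lemma finite_exponents_upto: "finite I \<Longrightarrow> finite (exponents_upto I D)"
  unfolding exponents_upto_def by (rule finite_subset[OF _ finite_PiE[of I "\<lambda>_. {..D}"]]) auto

lemma polynomials_upto_linear_combination:
  fixes f :: "'a \<Rightarrow> ('i \<Rightarrow> real) \<Rightarrow> real"
  assumes "\<And>a. a \<in> A \<Longrightarrow> f a \<in> polynomials_upto I D"
  shows "(\<lambda>Y. \<Sum>a\<in>A. w a * f a Y) \<in> polynomials_upto I D"
proof -
  have "\<forall>a\<in>A. \<exists>c. f a = (\<lambda>Y. \<Sum>\<alpha>\<in>exponents_upto I D. c \<alpha> * (\<Prod>i\<in>I. Y i ^ \<alpha> i))"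
    using assms by (auto simp: polynomials_upto_def)
  then obtain c where c: "\<And>a. a \<in> A \<Longrightarrow>
      f a = (\<lambda>Y. \<Sum>\<alpha>\<in>exponents_upto I D. c a \<alpha> * (\<Prod>i\<in>I. Y i ^ \<alpha> i))"
    by metis
  have "(\<lambda>Y. \<Sum>a\<in>A. w a * f a Y) =
      (\<lambda>Y. \<Sum>\<alpha>\<in>exponents_upto I D. (\<Sum>a\<in>A. w a * c a \<alpha>) * (\<Prod>i\<in>I. Y i ^ \<alpha> i))"
  proof
    fix Y :: "'i \<Rightarrow> real"
    have "(\<Sum>a\<in>A. w a * f a Y) =
        (\<Sum>a\<in>A. \<Sum>\<alpha>\<in>exponents_upto I D. w a * c a \<alpha> * (\<Prod>i\<in>I. Y i ^ \<alpha> i))"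
      by (intro sum.cong) (simp_all add: c sum_distrib_left mult.assoc)
    also have "\<dots> = (\<Sum>\<alpha>\<in>exponents_upto I D. (\<Sum>a\<in>A. w a * c a \<alpha>) * (\<Prod>i\<in>I. Y i ^ \<alpha> i))"
      by (subst sum.swap) (simp add: sum_distrib_right)
    finally show "(\<Sum>a\<in>A. w a * f a Y) = \<dots>" .
  qed
  then show ?thesis
    unfolding polynomials_upto_def by (intro CollectI exI)
qed

definition hermite_prod :: "'i set \<Rightarrow> ('i \<Rightarrow> nat) \<Rightarrow> ('i \<Rightarrow> real) \<Rightarrow> real" where
  "hermite_prod I \<alpha> Y = (\<Prod>i\<in>I. poly (hermite (\<alpha> i)) (Y i))"

text \<open>
  Sums over the box of all exponent vectors bounded by \<open>D\<close> factor over the coordinates,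
  whereas the polynomials are indexed by vectors of total degree at most \<open>D\<close>. This lemma
  shows that the summands in the difference vanish: one coordinate exceeds its partner.
\<close>

lemma exponents_upto_exceeds:
  assumes "\<alpha> \<in> exponents_upto I D" "\<beta> \<in> (I \<rightarrow>\<^sub>E {..D}) - exponents_upto I D"
  shows "\<exists>i\<in>I. \<alpha> i < \<beta> i"
proof (rule ccontr)
  assume "\<not> ?thesis"
  then have "(\<Sum>i\<in>I. \<beta> i) \<le> (\<Sum>i\<in>I. \<alpha> i)"
    by (intro sum_mono) (auto simp: not_less)
  then show False
    using assms by (auto simp: exponents_upto_def)
qed

lemma hermite_prod_in_polynomials_upto:
  assumes I: "finite I" and \<alpha>: "\<alpha> \<in> exponents_upto I D"
  shows "hermite_prod I \<alpha> \<in> polynomials_upto I D"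
proof -
  define c where "c \<beta> = (\<Prod>i\<in>I. coeff (hermite (\<alpha> i)) (\<beta> i))" for \<beta>
  have "hermite_prod I \<alpha> Y = (\<Sum>\<beta>\<in>exponents_upto I D. c \<beta> * (\<Prod>i\<in>I. Y i ^ \<beta> i))" for Y
  proof -
    have "hermite_prod I \<alpha> Y = (\<Prod>i\<in>I. \<Sum>k\<le>D. coeff (hermite (\<alpha> i)) k * Y i ^ k)"
      unfolding hermite_prod_def
    proof (rule prod.cong)
      fix i assume "i \<in> I"
      then have "\<alpha> i \<le> D"
        using \<alpha> by (auto simp: exponents_upto_def)
      then have "degree (hermite (\<alpha> i)) \<le> D"
        using degree_hermite_le order_trans by blast
      then show "poly (hermite (\<alpha> i)) (Y i) = (\<Sum>k\<le>D. coeff (hermite (\<alpha> i)) k * Y i ^ k)"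
        by (auto simp: poly_altdef intro!: sum.mono_neutral_left le_degree)
    qed simp
    also have "\<dots> = (\<Sum>\<beta>\<in>I \<rightarrow>\<^sub>E {..D}. c \<beta> * (\<Prod>i\<in>I. Y i ^ \<beta> i))"
      using I by (simp add: prod_sum_PiE c_def prod.distrib)
    also have "\<dots> = (\<Sum>\<beta>\<in>exponents_upto I D. c \<beta> * (\<Prod>i\<in>I. Y i ^ \<beta> i))"
    proof (rule sum.mono_neutral_right)
      show "\<forall>\<beta>\<in>(I \<rightarrow>\<^sub>E {..D}) - exponents_upto I D. c \<beta> * (\<Prod>i\<in>I. Y i ^ \<beta> i) = 0"
      proof
        fix \<beta> assume "\<beta> \<in> (I \<rightarrow>\<^sub>E {..D}) - exponents_upto I D"
        then obtain i where i: "i \<in> I" "\<alpha> i < \<beta> i"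
          using exponents_upto_exceeds[OF \<alpha>] by blast
        then have "coeff (hermite (\<alpha> i)) (\<beta> i) = 0"
          using degree_hermite_le[of "\<alpha> i"] by (intro coeff_eq_0) linarith
        then have "c \<beta> = 0"
          using i I by (auto simp: c_def)
        then show "c \<beta> * (\<Prod>i\<in>I. Y i ^ \<beta> i) = 0" by simp
      qed
    qed (use I in \<open>auto simp: exponents_upto_def intro!: finite_PiE\<close>)
    finally show ?thesis .
  qed
  then show ?thesis
    unfolding polynomials_upto_def by blast
qed

text \<open>
  The exponential series in several variables, cut off at total degree \<open>D\<close>. Splitting off one
  variable leaves a truncation at \<open>D - k\<close>, which is why \<open>D\<close> is arbitrary in the induction.
\<close>

lemma truncated_exp_sum:
  fixes a :: "'i \<Rightarrow> real"
  assumes "finite I"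
  shows "(\<Sum>\<alpha>\<in>exponents_upto I D. \<Prod>i\<in>I. a i ^ \<alpha> i / fact (\<alpha> i)) = (\<Sum>d\<le>D. (\<Sum>i\<in>I. a i) ^ d / fact d)"
  using assms
proof (induction I arbitrary: D rule: finite_induct)
  case empty
  have "exponents_upto ({} :: 'i set) D = {\<lambda>_. undefined}"
    by (auto simp: exponents_upto_def)
  moreover have "(\<Sum>d\<le>D. (0::real) ^ d / fact d) = (\<Sum>d\<in>{0}. 0 ^ d / fact d)"
    by (rule sum.mono_neutral_right) auto
  ultimately show ?case by simp
next
  case (insert j I)
  define s where "s = (\<Sum>i\<in>I. a i)"
  have "(\<Sum>\<alpha>\<in>exponents_upto (insert j I) D. \<Prod>i\<in>insert j I. a i ^ \<alpha> i / fact (\<alpha> i)) =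
      (\<Sum>(k, \<alpha>)\<in>(SIGMA k:{..D}. exponents_upto I (D - k)). a j ^ k / fact k * (\<Prod>i\<in>I. a i ^ \<alpha> i / fact (\<alpha> i)))"
  proof (rule sum.reindex_bij_witness[where j = "\<lambda>\<alpha>. (\<alpha> j, restrict \<alpha> I)" and i = "\<lambda>(k, \<alpha>). \<alpha>(j := k)"])
    fix \<alpha> assume \<alpha>: "\<alpha> \<in> exponents_upto (insert j I) D"
    then have sum: "\<alpha> j + (\<Sum>i\<in>I. \<alpha> i) \<le> D" and ext: "\<alpha> \<in> extensional (insert j I)"
      using insert.hyps by (auto simp: exponents_upto_def PiE_def)
    have "\<alpha> i \<le> (\<Sum>i\<in>I. \<alpha> i)" if "i \<in> I" for i
      using that insert.hyps by (intro member_le_sum) auto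
    then have "\<alpha> i \<le> D - \<alpha> j" if "i \<in> I" for i
      using that sum by fastforce
    then show "(\<alpha> j, restrict \<alpha> I) \<in> (SIGMA k:{..D}. exponents_upto I (D - k))"
      using sum by (auto simp: exponents_upto_def)
    show "(case (\<alpha> j, restrict \<alpha> I) of (k, \<alpha>) \<Rightarrow> \<alpha>(j := k)) = \<alpha>"
      using ext by (auto simp: extensional_def restrict_def)
    show "(case (\<alpha> j, restrict \<alpha> I) of (k, \<alpha>) \<Rightarrow> a j ^ k / fact k * (\<Prod>i\<in>I. a i ^ \<alpha> i / fact (\<alpha> i))) =
        (\<Prod>i\<in>insert j I. a i ^ \<alpha> i / fact (\<alpha> i))"
      using insert.hyps by simp
  next
    fix k\<alpha> assume k\<alpha>: "k\<alpha> \<in> (SIGMA k:{..D}. exponents_upto I (D - k))"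
    obtain k \<alpha> where [simp]: "k\<alpha> = (k, \<alpha>)" by fastforce
    have \<alpha>: "\<alpha> \<in> I \<rightarrow>\<^sub>E {..D - k}" "(\<Sum>i\<in>I. \<alpha> i) \<le> D - k" "k \<le> D"
      using k\<alpha> by (auto simp: exponents_upto_def)
    have upd: "(\<Sum>i\<in>I. (\<alpha>(j := k)) i) = (\<Sum>i\<in>I. \<alpha> i)"
      using insert.hyps by (intro sum.cong) auto
    have "\<alpha> i \<le> D" if "i \<in> I" for i
      using \<alpha>(1) that by (meson PiE_mem atMost_iff diff_le_self order_trans)
    then have "\<alpha>(j := k) \<in> insert j I \<rightarrow>\<^sub>E {..D}"
      using \<alpha> by (simp add: PiE_iff extensional_def)
    moreover have "(\<Sum>i\<in>insert j I. (\<alpha>(j := k)) i) \<le> D"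
      using insert.hyps \<alpha> upd by simp
    ultimately show "(case k\<alpha> of (k, \<alpha>) \<Rightarrow> \<alpha>(j := k)) \<in> exponents_upto (insert j I) D"
      by (simp add: exponents_upto_def)
    show "((case k\<alpha> of (k, \<alpha>) \<Rightarrow> \<alpha>(j := k)) j, restrict (case k\<alpha> of (k, \<alpha>) \<Rightarrow> \<alpha>(j := k)) I) = k\<alpha>"
      using insert.hyps \<alpha> by (auto simp: PiE_iff extensional_def restrict_def fun_eq_iff)
  qed
  also have "\<dots> = (\<Sum>k\<le>D. \<Sum>\<alpha>\<in>exponents_upto I (D - k). a j ^ k / fact k * (\<Prod>i\<in>I. a i ^ \<alpha> i / fact (\<alpha> i)))"
    using insert.hyps by (subst sum.Sigma) (auto intro: finite_exponents_upto)
  also have "\<dots> = (\<Sum>k\<le>D. \<Sum>d\<le>D - k. a j ^ k / fact k * (s ^ d / fact d))"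
    by (simp only: insert.IH s_def sum_distrib_left[symmetric])
  also have "\<dots> = (\<Sum>(k, d)\<in>{(k, d). k + d \<le> D}. a j ^ k / fact k * (s ^ d / fact d))"
    by (subst sum.Sigma) (auto intro!: sum.cong)
  also have "\<dots> = (\<Sum>m\<le>D. \<Sum>k\<le>m. a j ^ k / fact k * (s ^ (m - k) / fact (m - k)))"
    by (rule sum.triangle_reindex_eq)
  also have "\<dots> = (\<Sum>m\<le>D. (a j + s) ^ m / fact m)"
    using exp_series_add_commuting[of "a j" s] by (simp add: mult.commute field_simps)
  finally show ?case
    using insert.hyps by (simp add: s_def)
qed

section \<open>Hermite polynomials in independent Gaussians\<close>

abbreviation gaussian :: "'i set \<Rightarrow> ('i \<Rightarrow> real) measure" where
  "gaussian I \<equiv> PiM I (\<lambda>_. std_normal_distribution)"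

lemma product_prob_space_gaussian: "product_prob_space (\<lambda>_. std_normal_distribution)"
  by (rule product_prob_spaceI) (rule prob_space_std_normal)

lemma product_sigma_finite_gaussian: "product_sigma_finite (\<lambda>_. std_normal_distribution)"
  using product_prob_space_gaussian by (rule product_prob_space.axioms(1))

lemma prob_space_gaussian: "prob_space (gaussian I)"
  by (rule prob_space_PiM) (rule prob_space_std_normal)

lemmas integrable_gaussian_prod =
  product_sigma_finite.product_integrable_prod[OF product_sigma_finite_gaussian]

lemmas integral_gaussian_prod =
  product_sigma_finite.product_integral_prod[OF product_sigma_finite_gaussian]

lemma integrable_shifted_power: "integrable std_normal_distribution (\<lambda>z. (u + z) ^ b)"
  by (rule integrable_std_normal_if_poly[where q = "[:u, 1:] ^ b"]) simp

lemma integrable_hermite_power: "integrable std_normal_distribution (\<lambda>z. poly (hermite a) z * z ^ b)"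
  by (rule integrable_std_normal_if_poly[where q = "hermite a * monom 1 b"]) (simp add: poly_monom)

lemma integrable_polynomials_upto_mult:
  assumes I: "finite I" and f: "f \<in> polynomials_upto I D" and g: "g \<in> polynomials_upto I D"
  shows "integrable (gaussian I) (\<lambda>Y. f Y * g Y)"
proof -
  obtain c where c: "f = (\<lambda>Y. \<Sum>\<alpha>\<in>exponents_upto I D. c \<alpha> * (\<Prod>i\<in>I. Y i ^ \<alpha> i))"
    using f by (auto simp: polynomials_upto_def)
  obtain d where d: "g = (\<lambda>Y. \<Sum>\<beta>\<in>exponents_upto I D. d \<beta> * (\<Prod>i\<in>I. Y i ^ \<beta> i))"
    using g by (auto simp: polynomials_upto_def)
  have "integrable (gaussian I) (\<lambda>Y. \<Sum>\<alpha>\<in>exponents_upto I D. \<Sum>\<beta>\<in>exponents_upto I D.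
      (c \<alpha> * d \<beta>) * (\<Prod>i\<in>I. Y i ^ (\<alpha> i + \<beta> i)))"
    by (intro Bochner_Integration.integrable_sum integrable_mult_right integrable_gaussian_prod I
        integrable_std_normal_distribution_moment)
  then show ?thesis
    by (simp add: c d sum_product power_add prod.distrib mult_ac)
qed

lemma hermite_prod_orthogonal:
  assumes "finite I" "\<alpha> \<in> exponents_upto I D" "\<beta> \<in> exponents_upto I D"
  shows "(\<integral>Y. hermite_prod I \<alpha> Y * hermite_prod I \<beta> Y \<partial>gaussian I) =
    (if \<alpha> = \<beta> then \<Prod>i\<in>I. fact (\<alpha> i) else 0)"
proof -
  have "(\<integral>Y. hermite_prod I \<alpha> Y * hermite_prod I \<beta> Y \<partial>gaussian I) =
      (\<Prod>i\<in>I. \<integral>z. poly (hermite (\<alpha> i)) z * poly (hermite (\<beta> i)) z \<partial>std_normal_distribution)"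
    unfolding hermite_prod_def prod.distrib[symmetric]
    by (intro integral_gaussian_prod assms(1) integrable_poly_mult_std_normal)
  also have "\<dots> = (\<Prod>i\<in>I. if \<alpha> i = \<beta> i then fact (\<alpha> i) else 0)"
    by (simp add: hermite_orthogonal)
  also have "\<dots> = (if \<alpha> = \<beta> then \<Prod>i\<in>I. fact (\<alpha> i) else 0)"
  proof (cases "\<alpha> = \<beta>")
    case False
    moreover have "\<alpha> \<in> extensional I" "\<beta> \<in> extensional I"
      using assms by (auto simp: exponents_upto_def PiE_def)
    ultimately obtain i where "i \<in> I" "\<alpha> i \<noteq> \<beta> i"
      by (metis extensionalityI)
    then show ?thesis using False assms(1) by auto
  qed simp
  finally show ?thesis .
qed

text \<open>
  The one-dimensional expansions multiply to a sum over a box. It may be cut down to total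
  degree at most \<open>D\<close> because Hermite polynomials are orthogonal to lower powers.
\<close>

lemma gaussian_mean_shifted_monomial:
  assumes I: "finite I" and \<beta>: "\<beta> \<in> exponents_upto I D"
  shows "(\<integral>Z. (\<Prod>i\<in>I. (u i + Z i) ^ \<beta> i) \<partial>gaussian I) =
    (\<Sum>\<alpha>\<in>exponents_upto I D. (\<Prod>i\<in>I. u i ^ \<alpha> i / fact (\<alpha> i)) *
       (\<integral>Y. hermite_prod I \<alpha> Y * (\<Prod>i\<in>I. Y i ^ \<beta> i) \<partial>gaussian I))"
proof -
  define m where "m a b = (\<integral>z. poly (hermite a) z * z ^ b \<partial>std_normal_distribution)" for a b
  have "(\<integral>Z. (\<Prod>i\<in>I. (u i + Z i) ^ \<beta> i) \<partial>gaussian I) =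
      (\<Prod>i\<in>I. \<integral>z. (u i + z) ^ \<beta> i \<partial>std_normal_distribution)"
    by (intro integral_gaussian_prod I integrable_shifted_power)
  also have "\<dots> = (\<Prod>i\<in>I. \<Sum>a\<le>D. u i ^ a / fact a * m a (\<beta> i))"
  proof (rule prod.cong)
    fix i assume "i \<in> I"
    then have "\<beta> i \<le> D"
      using \<beta> by (auto simp: exponents_upto_def)
    then show "(\<integral>z. (u i + z) ^ \<beta> i \<partial>std_normal_distribution) = (\<Sum>a\<le>D. u i ^ a / fact a * m a (\<beta> i))"
      unfolding gaussian_mean_shifted_power m_def
      by (intro sum.mono_neutral_left) (auto simp: gaussian_mean_hermite_power_eq_0)
  qed simp
  also have "\<dots> = (\<Sum>\<alpha>\<in>I \<rightarrow>\<^sub>E {..D}. (\<Prod>i\<in>I. u i ^ \<alpha> i / fact (\<alpha> i)) * (\<Prod>i\<in>I. m (\<alpha> i) (\<beta> i)))"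
    using I by (simp add: prod_sum_PiE flip: prod.distrib)
  also have "\<dots> = (\<Sum>\<alpha>\<in>exponents_upto I D. (\<Prod>i\<in>I. u i ^ \<alpha> i / fact (\<alpha> i)) * (\<Prod>i\<in>I. m (\<alpha> i) (\<beta> i)))"
  proof (rule sum.mono_neutral_right)
    show "\<forall>\<alpha>\<in>(I \<rightarrow>\<^sub>E {..D}) - exponents_upto I D.
        (\<Prod>i\<in>I. u i ^ \<alpha> i / fact (\<alpha> i)) * (\<Prod>i\<in>I. m (\<alpha> i) (\<beta> i)) = 0"
    proof
      fix \<alpha> assume "\<alpha> \<in> (I \<rightarrow>\<^sub>E {..D}) - exponents_upto I D"
      then obtain i where "i \<in> I" "\<beta> i < \<alpha> i"
        using exponents_upto_exceeds[OF \<beta>] by blast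
      then have "(\<Prod>i\<in>I. m (\<alpha> i) (\<beta> i)) = 0"
        using I by (auto simp: m_def gaussian_mean_hermite_power_eq_0 intro!: bexI[of _ i])
      then show "(\<Prod>i\<in>I. u i ^ \<alpha> i / fact (\<alpha> i)) * (\<Prod>i\<in>I. m (\<alpha> i) (\<beta> i)) = 0"
        by simp
    qed
  qed (use I in \<open>auto simp: exponents_upto_def intro!: finite_PiE\<close>)
  also have "\<dots> = (\<Sum>\<alpha>\<in>exponents_upto I D. (\<Prod>i\<in>I. u i ^ \<alpha> i / fact (\<alpha> i)) *
       (\<integral>Y. hermite_prod I \<alpha> Y * (\<Prod>i\<in>I. Y i ^ \<beta> i) \<partial>gaussian I))"
    unfolding hermite_prod_def m_def prod.distrib[symmetric]
      integral_gaussian_prod[OF I integrable_hermite_power] ..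
  finally show ?thesis .
qed

section \<open>Additive Gaussian models\<close>

text \<open>
  The signal \<open>u\<close> stays general because the low-degree norm depends on it only through the
  inner products \<open>\<langle>u(x), u(x')\<rangle>\<close>.
\<close>

definition additive_gaussian_model ::
    "'i set \<Rightarrow> 'x pmf \<Rightarrow> ('x \<Rightarrow> 'i \<Rightarrow> real) \<Rightarrow> ('i \<Rightarrow> real) measure" where
  "additive_gaussian_model I \<mu> u =
     distr (measure_pmf \<mu> \<Otimes>\<^sub>M gaussian I) (PiM I (\<lambda>_. borel)) (\<lambda>(x, Z). \<lambda>i\<in>I. u x i + Z i)"

lemma sets_gaussian: "sets (gaussian I) = sets (PiM I (\<lambda>_. borel))"
  by (rule sets_PiM_cong) auto

lemma measurable_shift:
  "(\<lambda>Z. \<lambda>i\<in>I. v i + Z i) \<in> gaussian I \<rightarrow>\<^sub>M PiM I (\<lambda>_. borel)"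
proof (rule measurable_restrict)
  fix i assume "i \<in> I"
  then have "(\<lambda>Z. Z i) \<in> gaussian I \<rightarrow>\<^sub>M std_normal_distribution"
    by (rule measurable_component_singleton)
  then show "(\<lambda>Z. v i + Z i) \<in> gaussian I \<rightarrow>\<^sub>M borel"
    by simp
qed

lemma measurable_additive_gaussian:
  "(\<lambda>(x, Z). \<lambda>i\<in>I. u x i + Z i) \<in> measure_pmf \<mu> \<Otimes>\<^sub>M gaussian I \<rightarrow>\<^sub>M PiM I (\<lambda>_. borel)"
  unfolding case_prod_unfold
proof (rule measurable_restrict)
  fix i assume "i \<in> I"
  then have "(\<lambda>Z. Z i) \<in> gaussian I \<rightarrow>\<^sub>M std_normal_distribution"
    by (rule measurable_component_singleton)
  then have 1: "(\<lambda>p. snd p i) \<in> measure_pmf \<mu> \<Otimes>\<^sub>M gaussian I \<rightarrow>\<^sub>M borel"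
    by (intro measurable_compose[OF measurable_snd]) simp
  have 2: "(\<lambda>p. u (fst p) i) \<in> measure_pmf \<mu> \<Otimes>\<^sub>M gaussian I \<rightarrow>\<^sub>M borel"
    by (rule measurable_compose[OF measurable_fst]) simp
  show "(\<lambda>p. u (fst p) i + snd p i) \<in> measure_pmf \<mu> \<Otimes>\<^sub>M gaussian I \<rightarrow>\<^sub>M borel"
    using 2 1 by (rule borel_measurable_add)
qed

lemma distr_shift_std_normal:
  "distr std_normal_distribution borel (\<lambda>z. v + z) =
     density std_normal_distribution (\<lambda>y. ennreal (exp (v * y - v\<^sup>2 / 2)))"
proof (rule measure_eqI)
  fix A assume "A \<in> sets (distr std_normal_distribution borel (\<lambda>z. v + z))"
  then have A [measurable]: "A \<in> sets borel" by simp
  have "emeasure (distr std_normal_distribution borel (\<lambda>z. v + z)) A =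
      (\<integral>\<^sup>+z. indicator A (v + z) \<partial>std_normal_distribution)"
    using nn_integral_distr[of "\<lambda>z. v + z" std_normal_distribution borel "indicator A"] by simp
  also have "\<dots> = (\<integral>\<^sup>+z. ennreal (std_normal_density z) * indicator A (v + z) \<partial>lborel)"
    by (simp add: nn_integral_density)
  also have "\<dots> = (\<integral>\<^sup>+y. ennreal (std_normal_density (y - v)) * indicator A y \<partial>lborel)"
    using nn_integral_real_affine[of "\<lambda>y. ennreal (std_normal_density (y - v)) * indicator A y" 1 v]
    by simp
  also have "\<dots> = (\<integral>\<^sup>+y. ennreal (std_normal_density y) * (ennreal (exp (v * y - v\<^sup>2 / 2)) * indicator A y) \<partial>lborel)"
  proof (rule nn_integral_cong)
    fix y
    have "std_normal_density (y - v) = std_normal_density y * exp (v * y - v\<^sup>2 / 2)"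
      by (simp add: std_normal_density_def exp_add[symmetric] exp_diff[symmetric] power2_eq_square field_simps)
    then show "ennreal (std_normal_density (y - v)) * indicator A y =
        ennreal (std_normal_density y) * (ennreal (exp (v * y - v\<^sup>2 / 2)) * indicator A y)"
      by (simp add: ennreal_mult' mult.assoc)
  qed
  also have "\<dots> = emeasure (density std_normal_distribution (\<lambda>y. ennreal (exp (v * y - v\<^sup>2 / 2)))) A"
    by (simp add: emeasure_density nn_integral_density)
  finally show "emeasure (distr std_normal_distribution borel (\<lambda>z. v + z)) A = \<dots>" .
qed simp

text \<open>
  The Cameron--Martin formula in finite dimension. Both sides are product measures with the
  same factors, so they agree on boxes.
\<close>

lemma distr_shift_gaussian:
  assumes I: "finite I"
  shows "distr (gaussian I) (PiM I (\<lambda>_. borel)) (\<lambda>Z. \<lambda>i\<in>I. v i + Z i) =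
    density (gaussian I) (\<lambda>Y. \<Prod>i\<in>I. ennreal (exp (v i * Y i - (v i)\<^sup>2 / 2)))"
proof -
  interpret N: prob_space std_normal_distribution by (rule prob_space_std_normal)
  define M where "M i = distr std_normal_distribution borel (\<lambda>z. v i + z)" for i
  have "prob_space (M i)" for i
    unfolding M_def by (rule N.prob_space_distr) simp
  then interpret M: product_prob_space M
    by (intro product_prob_spaceI)
  interpret G: product_prob_space "\<lambda>_. std_normal_distribution"
    by (rule product_prob_space_gaussian)
  have sets_M: "sets (PiM I M) = sets (PiM I (\<lambda>_. borel))"
    by (rule sets_PiM_cong) (auto simp: M_def)
  have "distr (gaussian I) (PiM I (\<lambda>_. borel)) (\<lambda>Z. \<lambda>i\<in>I. v i + Z i) = PiM I M"
  proof (rule M.PiM_eqI)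
    fix A assume "\<And>i. i \<in> I \<Longrightarrow> A i \<in> sets (M i)"
    then have A: "\<And>i. i \<in> I \<Longrightarrow> A i \<in> sets borel"
      by (simp add: M_def)
    have pre: "(\<lambda>z. v i + z) -` A i \<in> sets borel" if "i \<in> I" for i
      using measurable_sets[of "\<lambda>z. v i + z" borel borel "A i"] A[OF that] by simp
    have "(\<lambda>Z. \<lambda>i\<in>I. v i + Z i) -` Pi\<^sub>E I A \<inter> space (gaussian I) = (\<Pi>\<^sub>E i\<in>I. (\<lambda>z. v i + z) -` A i)"
      by (auto simp: space_PiM PiE_iff)
    then have "emeasure (distr (gaussian I) (PiM I (\<lambda>_. borel)) (\<lambda>Z. \<lambda>i\<in>I. v i + Z i)) (Pi\<^sub>E I A) =
        emeasure (gaussian I) (\<Pi>\<^sub>E i\<in>I. (\<lambda>z. v i + z) -` A i)"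
      using A I by (subst emeasure_distr) (auto intro!: measurable_shift sets_PiM_I_finite)
    also have "\<dots> = (\<Prod>i\<in>I. emeasure std_normal_distribution ((\<lambda>z. v i + z) -` A i))"
      using pre by (intro G.emeasure_PiM I) simp
    also have "\<dots> = (\<Prod>i\<in>I. emeasure (M i) (A i))"
      using A by (intro prod.cong) (simp_all add: M_def emeasure_distr)
    finally show "emeasure (distr (gaussian I) (PiM I (\<lambda>_. borel)) (\<lambda>Z. \<lambda>i\<in>I. v i + Z i)) (Pi\<^sub>E I A) = \<dots>" .
  qed (simp_all add: I sets_M)
  also have "\<dots> = density (gaussian I) (\<lambda>Y. \<Prod>i\<in>I. ennreal (exp (v i * Y i - (v i)\<^sup>2 / 2)))"
  proof (rule M.PiM_eqI[symmetric])
    fix A assume "\<And>i. i \<in> I \<Longrightarrow> A i \<in> sets (M i)"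
    then have A: "\<And>i. i \<in> I \<Longrightarrow> A i \<in> sets borel"
      by (simp add: M_def)
    have box: "Pi\<^sub>E I A \<in> sets (gaussian I)"
      using A I by (intro sets_PiM_I_finite) auto
    have meas: "(\<lambda>Y. \<Prod>i\<in>I. ennreal (exp (v i * Y i - (v i)\<^sup>2 / 2))) \<in> borel_measurable (gaussian I)"
    proof (rule borel_measurable_prod_ennreal)
      fix i assume "i \<in> I"
      then have [measurable]: "(\<lambda>Y. Y i) \<in> borel_measurable (gaussian I)"
        using measurable_component_singleton[of i I "\<lambda>_. std_normal_distribution"] by simp
      show "(\<lambda>Y. ennreal (exp (v i * Y i - (v i)\<^sup>2 / 2))) \<in> borel_measurable (gaussian I)"
        by measurable
    qed
    have "emeasure (density (gaussian I) (\<lambda>Y. \<Prod>i\<in>I. ennreal (exp (v i * Y i - (v i)\<^sup>2 / 2)))) (Pi\<^sub>E I A) =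
        (\<integral>\<^sup>+Y. (\<Prod>i\<in>I. ennreal (exp (v i * Y i - (v i)\<^sup>2 / 2))) * indicator (Pi\<^sub>E I A) Y \<partial>gaussian I)"
      by (rule emeasure_density[OF meas box])
    also have "\<dots> = (\<integral>\<^sup>+Y. (\<Prod>i\<in>I. ennreal (exp (v i * Y i - (v i)\<^sup>2 / 2)) * indicator (A i) (Y i)) \<partial>gaussian I)"
    proof (rule nn_integral_cong)
      fix Y assume "Y \<in> space (gaussian I)"
      then have "indicator (Pi\<^sub>E I A) Y = (\<Prod>i\<in>I. indicator (A i) (Y i) :: ennreal)"
        using I by (auto simp: space_PiM PiE_iff indicator_def)
      then show "(\<Prod>i\<in>I. ennreal (exp (v i * Y i - (v i)\<^sup>2 / 2))) * indicator (Pi\<^sub>E I A) Y =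
          (\<Prod>i\<in>I. ennreal (exp (v i * Y i - (v i)\<^sup>2 / 2)) * indicator (A i) (Y i))"
        by (simp add: prod.distrib)
    qed
    also have "\<dots> = (\<Prod>i\<in>I. \<integral>\<^sup>+y. ennreal (exp (v i * y - (v i)\<^sup>2 / 2)) * indicator (A i) y \<partial>std_normal_distribution)"
      using A by (intro G.product_nn_integral_prod I) simp
    also have "\<dots> = (\<Prod>i\<in>I. emeasure (M i) (A i))"
      using A by (intro prod.cong) (simp_all add: M_def distr_shift_std_normal emeasure_density)
    finally show "emeasure (density (gaussian I) (\<lambda>Y. \<Prod>i\<in>I. ennreal (exp (v i * Y i - (v i)\<^sup>2 / 2)))) (Pi\<^sub>E I A) = \<dots>" .
  qed (simp_all add: I sets_M sets_gaussian)
  finally show ?thesis .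
qed

text \<open>
  The model is a mixture of shifted Gaussians, and each of these has a density with respect
  to the centred one. Absolute continuity is what turns integrals against the likelihood
  ratio into integrals under the planted law.
\<close>

lemma absolutely_continuous_additive_gaussian:
  assumes I: "finite I"
  shows "absolutely_continuous (gaussian I) (additive_gaussian_model I \<mu> u)"
  unfolding absolutely_continuous_def
proof
  fix A assume A: "A \<in> null_sets (gaussian I)"
  let ?T = "\<lambda>(x, Z). \<lambda>i\<in>I. u x i + Z i" and ?B = "PiM I (\<lambda>_. borel :: real measure)"
  interpret G: prob_space "gaussian I" by (rule prob_space_gaussian)
  have sets_A: "A \<in> sets ?B"
    using A sets_gaussian[of I] by auto
  have shift_null: "emeasure (gaussian I) ((\<lambda>Z. \<lambda>i\<in>I. u x i + Z i) -` A \<inter> space (gaussian I)) = 0" for x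
  proof -
    have "absolutely_continuous (gaussian I)
        (density (gaussian I) (\<lambda>Y. \<Prod>i\<in>I. ennreal (exp (u x i * Y i - (u x i)\<^sup>2 / 2))))"
    proof (rule absolutely_continuousI_density, rule borel_measurable_prod_ennreal)
      fix i assume "i \<in> I"
      then have [measurable]: "(\<lambda>Y. Y i) \<in> borel_measurable (gaussian I)"
        using measurable_component_singleton[of i I "\<lambda>_. std_normal_distribution"] by simp
      show "(\<lambda>Y. ennreal (exp (u x i * Y i - (u x i)\<^sup>2 / 2))) \<in> borel_measurable (gaussian I)"
        by measurable
    qed
    then have "A \<in> null_sets (distr (gaussian I) ?B (\<lambda>Z. \<lambda>i\<in>I. u x i + Z i))"
      using A by (auto simp: absolutely_continuous_def distr_shift_gaussian[OF I])
    then show ?thesis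
      using sets_A by (auto simp: null_sets_def emeasure_distr measurable_shift)
  qed
  have "emeasure (additive_gaussian_model I \<mu> u) A =
      emeasure (measure_pmf \<mu> \<Otimes>\<^sub>M gaussian I) (?T -` A \<inter> space (measure_pmf \<mu> \<Otimes>\<^sub>M gaussian I))"
    unfolding additive_gaussian_model_def
    by (rule emeasure_distr[OF measurable_additive_gaussian sets_A])
  also have "\<dots> = (\<integral>\<^sup>+x. emeasure (gaussian I) (Pair x -` (?T -` A \<inter> space (measure_pmf \<mu> \<Otimes>\<^sub>M gaussian I))) \<partial>\<mu>)"
    by (intro G.emeasure_pair_measure_alt measurable_sets[OF measurable_additive_gaussian sets_A])
  also have "\<dots> = (\<integral>\<^sup>+x. 0 \<partial>\<mu>)"
  proof (rule nn_integral_cong)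
    fix x
    have "Pair x -` (?T -` A \<inter> space (measure_pmf \<mu> \<Otimes>\<^sub>M gaussian I)) =
        (\<lambda>Z. \<lambda>i\<in>I. u x i + Z i) -` A \<inter> space (gaussian I)"
      by (auto simp: space_pair_measure)
    then show "emeasure (gaussian I) (Pair x -` (?T -` A \<inter> space (measure_pmf \<mu> \<Otimes>\<^sub>M gaussian I))) = 0"
      using shift_null by simp
  qed
  finally show "A \<in> null_sets (additive_gaussian_model I \<mu> u)"
    using sets_A by (auto simp: null_sets_def additive_gaussian_model_def)
qed

lemma prob_space_additive_gaussian: "prob_space (additive_gaussian_model I \<mu> u)"
proof -
  interpret G: prob_space "gaussian I" by (rule prob_space_gaussian)
  interpret pair_prob_space "measure_pmf \<mu>" "gaussian I" by standard
  show ?thesis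
    unfolding additive_gaussian_model_def
    by (rule prob_space_distr) (rule measurable_additive_gaussian)
qed

lemma measurable_monomial: "(\<lambda>Y. \<Prod>i\<in>I. Y i ^ \<beta> i) \<in> borel_measurable (PiM I (\<lambda>_. borel :: real measure))"
  by measurable

lemma additive_gaussian_monomial:
  assumes I: "finite I" and \<mu>: "finite (set_pmf \<mu>)"
  shows integrable_additive_gaussian_monomial:
      "integrable (additive_gaussian_model I \<mu> u) (\<lambda>Y. \<Prod>i\<in>I. Y i ^ \<beta> i)"
    and integral_additive_gaussian_monomial:
      "(\<integral>Y. (\<Prod>i\<in>I. Y i ^ \<beta> i) \<partial>additive_gaussian_model I \<mu> u) =
         (\<integral>x. (\<integral>Z. (\<Prod>i\<in>I. (u x i + Z i) ^ \<beta> i) \<partial>gaussian I) \<partial>\<mu>)"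
proof -
  interpret G: prob_space "gaussian I" by (rule prob_space_gaussian)
  interpret pair_prob_space "measure_pmf \<mu>" "gaussian I" by standard
  let ?m = "\<lambda>Y :: 'a \<Rightarrow> real. \<Prod>i\<in>I. Y i ^ \<beta> i" and ?T = "\<lambda>(x, Z). \<lambda>i\<in>I. u x i + Z i"
  have shifted: "?m (?T (x, Z)) = (\<Prod>i\<in>I. (u x i + Z i) ^ \<beta> i)" for x Z
    by (auto intro!: prod.cong)
  have int: "integrable (measure_pmf \<mu> \<Otimes>\<^sub>M gaussian I) (\<lambda>p. ?m (?T p))"
  proof (rule Fubini_integrable)
    show "(\<lambda>p. ?m (?T p)) \<in> borel_measurable (measure_pmf \<mu> \<Otimes>\<^sub>M gaussian I)"
      by (rule measurable_compose[OF measurable_additive_gaussian measurable_monomial])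
    show "integrable \<mu> (\<lambda>x. \<integral>Z. norm (?m (?T (x, Z))) \<partial>gaussian I)"
      by (rule integrable_measure_pmf_finite[OF \<mu>])
    show "AE x in \<mu>. integrable (gaussian I) (\<lambda>Z. ?m (?T (x, Z)))"
      unfolding shifted by (intro AE_I2 integrable_gaussian_prod I integrable_shifted_power)
  qed
  then show "integrable (additive_gaussian_model I \<mu> u) ?m"
    unfolding additive_gaussian_model_def
    by (subst integrable_distr_eq[OF measurable_additive_gaussian measurable_monomial])
  have "(\<integral>Y. ?m Y \<partial>additive_gaussian_model I \<mu> u) = (\<integral>p. ?m (?T p) \<partial>(measure_pmf \<mu> \<Otimes>\<^sub>M gaussian I))"
    unfolding additive_gaussian_model_def
    by (rule integral_distr[OF measurable_additive_gaussian measurable_monomial])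
  also have "\<dots> = (\<integral>x. (\<integral>Z. ?m (?T (x, Z)) \<partial>gaussian I) \<partial>\<mu>)"
    by (rule integral_fst'[symmetric]) (rule int)
  finally show "(\<integral>Y. ?m Y \<partial>additive_gaussian_model I \<mu> u) =
      (\<integral>x. (\<integral>Z. (\<Prod>i\<in>I. (u x i + Z i) ^ \<beta> i) \<partial>gaussian I) \<partial>\<mu>)"
    unfolding shifted .
qed

text \<open>
  The Hermite expansion \<open>g\<close> with coefficients \<open>E[u(x)\<^sup>\<alpha>] / \<alpha>!\<close> is a polynomial of degree at
  most \<open>D\<close> with the same inner products with monomials as the likelihood ratio, hence a
  projection of it. Its norm follows from orthogonality, two copies of the prior, and the
  multivariate exponential series.
\<close>

lemma additive_gaussian_low_degree_norm:
  fixes u :: "'x \<Rightarrow> 'i \<Rightarrow> real"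
  assumes I: "finite I" and \<mu>: "finite (set_pmf \<mu>)"
  shows "(L2_norm (gaussian I) (L2_projection (gaussian I) (polynomials_upto I D)
      (\<lambda>Y. enn2real (RN_deriv (gaussian I) (additive_gaussian_model I \<mu> u) Y))))\<^sup>2 =
    (\<integral>x. (\<integral>x'. (\<Sum>d\<le>D. (\<Sum>i\<in>I. u x i * u x' i) ^ d / fact d) \<partial>\<mu>) \<partial>\<mu>)"
proof -
  let ?Q = "gaussian I" and ?P = "additive_gaussian_model I \<mu> u"
    and ?E = "exponents_upto I D" and ?V = "polynomials_upto I D"
  define L where "L Y = enn2real (RN_deriv ?Q ?P Y)" for Y
  define c where "c \<alpha> = (\<integral>x. (\<Prod>i\<in>I. u x i ^ \<alpha> i) \<partial>\<mu>)" for \<alpha>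
  define F where "F \<alpha> = (\<Prod>i\<in>I. fact (\<alpha> i) :: real)" for \<alpha> :: "'i \<Rightarrow> nat"
  define g where "g Y = (\<Sum>\<alpha>\<in>?E. c \<alpha> / F \<alpha> * hermite_prod I \<alpha> Y)" for Y
  interpret Q: prob_space ?Q by (rule prob_space_gaussian)
  interpret P: prob_space ?P by (rule prob_space_additive_gaussian)
  have finE: "finite ?E"
    using I by (rule finite_exponents_upto)
  have int_\<mu>: "integrable \<mu> f" for f :: "'x \<Rightarrow> real"
    by (rule integrable_measure_pmf_finite[OF \<mu>])
  have F_nz: "F \<alpha> \<noteq> 0" for \<alpha>
    using I by (simp add: F_def)
  have g_V: "g \<in> ?V"
    unfolding g_def using I
    by (intro polynomials_upto_linear_combination hermite_prod_in_polynomials_upto)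
  have monomial_V: "(\<lambda>Y. \<Prod>i\<in>I. Y i ^ \<beta> i) \<in> ?V" if "\<beta> \<in> ?E" for \<beta>
    unfolding polynomials_upto_def
    by (intro CollectI exI[of _ "\<lambda>\<alpha>. if \<alpha> = \<beta> then 1 else 0"])
      (use that finE in \<open>simp add: if_distrib[of "\<lambda>x. x * _"] cong: if_cong\<close>)
  have measurable_V: "h \<in> borel_measurable ?Q" if h_V: "h \<in> ?V" for h
  proof -
    obtain d where "h = (\<lambda>Y. \<Sum>\<beta>\<in>?E. d \<beta> * (\<Prod>i\<in>I. Y i ^ \<beta> i))"
      using h_V by (auto simp: polynomials_upto_def)
    then have "h \<in> borel_measurable (PiM I (\<lambda>_. borel))"
      by (auto intro!: borel_measurable_sum borel_measurable_times measurable_monomial)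
    then show ?thesis
      by (simp add: measurable_cong_sets[OF sets_gaussian refl])
  qed
  have sets_P: "sets ?P = sets ?Q"
    by (simp add: additive_gaussian_model_def sets_gaussian)
  have int_P: "integrable ?P h" if h_V: "h \<in> ?V" for h
  proof -
    obtain d where "h = (\<lambda>Y. \<Sum>\<beta>\<in>?E. d \<beta> * (\<Prod>i\<in>I. Y i ^ \<beta> i))"
      using h_V by (auto simp: polynomials_upto_def)
    then show ?thesis
      by (auto intro!: Bochner_Integration.integrable_sum integrable_mult_right
          integrable_additive_gaussian_monomial I \<mu>)
  qed
  note RN = P.sigma_finite_measure_axioms absolutely_continuous_additive_gaussian[OF I] sets_P
  have int_L: "integrable ?Q (\<lambda>Y. L Y * h Y)" if "h \<in> ?V" for h
    unfolding L_def using Q.RN_deriv_integrable[OF RN measurable_V[OF that]] int_P[OF that] by simp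
  have L_inner: "L2_inner ?Q L h = (\<integral>Y. h Y \<partial>?P)" if "h \<in> ?V" for h
    unfolding L_def L2_inner_def using Q.RN_deriv_integral[OF RN measurable_V[OF that]] by simp
  \<comment> \<open>averaging the expansion of a shifted monomial over the prior puts the coefficients of \<open>g\<close> in front\<close>
  have g_inner: "L2_inner ?Q g (\<lambda>Y. \<Prod>i\<in>I. Y i ^ \<beta> i) = (\<integral>Y. (\<Prod>i\<in>I. Y i ^ \<beta> i) \<partial>?P)"
    if \<beta>: "\<beta> \<in> ?E" for \<beta>
  proof -
    let ?m = "\<lambda>\<alpha>. \<integral>Y. hermite_prod I \<alpha> Y * (\<Prod>i\<in>I. Y i ^ \<beta> i) \<partial>?Q"
    have int_H: "integrable ?Q (\<lambda>Y. hermite_prod I \<alpha> Y * (\<Prod>i\<in>I. Y i ^ \<beta> i))" if "\<alpha> \<in> ?E" for \<alpha>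
      by (rule integrable_polynomials_upto_mult[OF I hermite_prod_in_polynomials_upto[OF I that] monomial_V[OF \<beta>]])
    have "L2_inner ?Q g (\<lambda>Y. \<Prod>i\<in>I. Y i ^ \<beta> i) =
        (\<integral>Y. (\<Sum>\<alpha>\<in>?E. c \<alpha> / F \<alpha> * (hermite_prod I \<alpha> Y * (\<Prod>i\<in>I. Y i ^ \<beta> i))) \<partial>?Q)"
      by (simp add: L2_inner_def g_def sum_distrib_right mult.assoc)
    also have "\<dots> = (\<Sum>\<alpha>\<in>?E. c \<alpha> / F \<alpha> * ?m \<alpha>)"
      using int_H by (subst Bochner_Integration.integral_sum) auto
    also have "\<dots> = (\<Sum>\<alpha>\<in>?E. (\<integral>x. (\<Prod>i\<in>I. u x i ^ \<alpha> i / fact (\<alpha> i)) \<partial>\<mu>) * ?m \<alpha>)"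
      by (simp add: c_def F_def prod_dividef)
    also have "\<dots> = (\<integral>x. (\<Sum>\<alpha>\<in>?E. (\<Prod>i\<in>I. u x i ^ \<alpha> i / fact (\<alpha> i)) * ?m \<alpha>) \<partial>\<mu>)"
      by (simp add: Bochner_Integration.integral_sum int_\<mu>)
    also have "\<dots> = (\<integral>Y. (\<Prod>i\<in>I. Y i ^ \<beta> i) \<partial>?P)"
      by (simp add: gaussian_mean_shifted_monomial[OF I \<beta>] integral_additive_gaussian_monomial[OF I \<mu>])
    finally show ?thesis .
  qed
  have g_proj: "L2_inner ?Q g h = L2_inner ?Q L h" if h_V: "h \<in> ?V" for h
  proof -
    obtain d where h: "h = (\<lambda>Y. \<Sum>\<beta>\<in>?E. d \<beta> * (\<Prod>i\<in>I. Y i ^ \<beta> i))"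
      using h_V by (auto simp: polynomials_upto_def)
    have "L2_inner ?Q g h = (\<integral>Y. (\<Sum>\<beta>\<in>?E. d \<beta> * (g Y * (\<Prod>i\<in>I. Y i ^ \<beta> i))) \<partial>?Q)"
      by (simp add: L2_inner_def h sum_distrib_left mult_ac)
    also have "\<dots> = (\<Sum>\<beta>\<in>?E. d \<beta> * (\<integral>Y. (\<Prod>i\<in>I. Y i ^ \<beta> i) \<partial>?P))"
      using I g_V monomial_V
      by (subst Bochner_Integration.integral_sum)
        (auto simp: g_inner[unfolded L2_inner_def] intro!: integrable_mult_right integrable_polynomials_upto_mult)
    also have "\<dots> = (\<integral>Y. h Y \<partial>?P)"
      unfolding h using integrable_additive_gaussian_monomial[OF I \<mu>]
      by (subst Bochner_Integration.integral_sum) auto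
    finally show ?thesis
      using L_inner[OF h_V] by simp
  qed
  have "(L2_norm ?Q (L2_projection ?Q ?V L))\<^sup>2 = (L2_norm ?Q g)\<^sup>2"
    using g_V g_proj int_L integrable_polynomials_upto_mult[OF I]
    by (subst L2_norm_projection) auto
  also have "\<dots> = L2_inner ?Q g g"
    unfolding L2_norm_def by (rule real_sqrt_pow2) (simp add: L2_inner_def)
  also have "\<dots> = (\<integral>Y. (\<Sum>\<alpha>\<in>?E. \<Sum>\<beta>\<in>?E. c \<alpha> / F \<alpha> * (c \<beta> / F \<beta>) *
      (hermite_prod I \<alpha> Y * hermite_prod I \<beta> Y)) \<partial>?Q)"
    by (simp add: L2_inner_def g_def sum_product mult_ac)
  also have "\<dots> = (\<Sum>\<alpha>\<in>?E. \<Sum>\<beta>\<in>?E. c \<alpha> / F \<alpha> * (c \<beta> / F \<beta>) *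
      (\<integral>Y. hermite_prod I \<alpha> Y * hermite_prod I \<beta> Y \<partial>?Q))"
  proof -
    have int_HH: "integrable ?Q (\<lambda>Y. w * (hermite_prod I \<alpha> Y * hermite_prod I \<beta> Y))"
      if "\<alpha> \<in> ?E" "\<beta> \<in> ?E" for \<alpha> \<beta> w
      using I that
      by (intro integrable_mult_right integrable_polynomials_upto_mult hermite_prod_in_polynomials_upto)
    show ?thesis
      using int_HH by (simp add: Bochner_Integration.integral_sum Bochner_Integration.integrable_sum)
  qed
  also have "\<dots> = (\<Sum>\<alpha>\<in>?E. \<Sum>\<beta>\<in>?E. if \<alpha> = \<beta> then c \<alpha> / F \<alpha> * (c \<beta> / F \<beta>) * F \<alpha> else 0)"
    by (intro sum.cong refl) (simp add: hermite_prod_orthogonal[OF I] F_def)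
  also have "\<dots> = (\<Sum>\<alpha>\<in>?E. c \<alpha> * c \<alpha> / F \<alpha>)"
    using finE F_nz by (simp add: sum.delta)
  \<comment> \<open>the square of a mean is a mean over two independent copies\<close>
  also have "\<dots> = (\<Sum>\<alpha>\<in>?E. \<integral>x. (\<integral>x'. (\<Prod>i\<in>I. (u x i * u x' i) ^ \<alpha> i / fact (\<alpha> i)) \<partial>\<mu>) \<partial>\<mu>)"
    by (simp add: c_def F_def prod_dividef power_mult_distrib prod.distrib)
  also have "\<dots> = (\<integral>x. (\<integral>x'. (\<Sum>\<alpha>\<in>?E. \<Prod>i\<in>I. (u x i * u x' i) ^ \<alpha> i / fact (\<alpha> i)) \<partial>\<mu>) \<partial>\<mu>)"
    by (simp add: Bochner_Integration.integral_sum int_\<mu>)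
  also have "\<dots> = (\<integral>x. (\<integral>x'. (\<Sum>d\<le>D. (\<Sum>i\<in>I. u x i * u x' i) ^ d / fact d) \<partial>\<mu>) \<partial>\<mu>)"
    by (simp only: truncated_exp_sum[OF I])
  finally show ?thesis
    by (simp add: L_def[abs_def])
qed

section \<open>Moments of a sum of random signs\<close>

definition sign_sum_moment :: "nat \<Rightarrow> nat \<Rightarrow> real" where
  "sign_sum_moment n m = (\<integral>x. (\<Sum>k<n. x k) ^ m \<partial>rademacher_prior n)"

lemma rademacher_prior_uniform: "rademacher_prior n = pmf_of_set (PiE_dflt {..<n} 0 (\<lambda>_. {-1, 1}))"
  unfolding rademacher_prior_def by (rule Pi_pmf_of_set) auto

lemma finite_sign_vectors: "finite (PiE_dflt {..<n::nat} 0 (\<lambda>_. {-1, 1 :: real}))"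
  by (rule finite_PiE_dflt) auto

lemma set_rademacher_prior: "set_pmf (rademacher_prior n) = PiE_dflt {..<n} 0 (\<lambda>_. {-1, 1})"
  unfolding rademacher_prior_uniform by (rule set_pmf_of_set) (auto intro: finite_sign_vectors)

lemma finite_set_rademacher_prior: "finite (set_pmf (rademacher_prior n))"
  by (simp add: set_rademacher_prior finite_sign_vectors)

lemma integrable_rademacher_prior: "integrable (rademacher_prior n) (f :: _ \<Rightarrow> real)"
  by (rule integrable_measure_pmf_finite[OF finite_set_rademacher_prior])

text \<open>
  Multiplying coordinatewise by a fixed sign vector is an involution of the sign vectors, so
  it preserves the uniform law. This reduces \<open>\<langle>x, x'\<rangle>\<close> to a sum of signs.
\<close>

lemma rademacher_expectation_mult:
  assumes x: "x \<in> set_pmf (rademacher_prior n)"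
  shows "(\<integral>x'. f (\<lambda>k. x k * x' k) \<partial>rademacher_prior n) = (\<integral>x'. (f x' :: real) \<partial>rademacher_prior n)"
proof -
  let ?S = "PiE_dflt {..<n} 0 (\<lambda>_. {-1, 1 :: real})"
  have x: "x k = -1 \<or> x k = 1" if "k < n" for k
    using assms that by (auto simp: set_rademacher_prior PiE_dflt_def)
  have x0: "x k = 0" if "\<not> k < n" for k
    using assms that by (auto simp: set_rademacher_prior PiE_dflt_def)
  have mult: "(\<lambda>k. x k * y k) \<in> ?S" if y: "y \<in> ?S" for y
    unfolding PiE_dflt_def
  proof (intro CollectI allI conjI impI)
    fix k assume k: "k \<in> {..<n}"
    then have "y k = -1 \<or> y k = 1"
      using y by (auto simp: PiE_dflt_def)
    with x[of k] k show "x k * y k \<in> {-1, 1}" by auto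
  qed (simp add: x0)
  have inv: "(\<lambda>k. x k * (x k * y k)) = y" if y: "y \<in> ?S" for y
  proof
    fix k
    show "x k * (x k * y k) = y k"
    proof (cases "k < n")
      case True
      then have "x k * x k = 1"
        using x[of k] by auto
      then show ?thesis
        by (simp flip: mult.assoc)
    next
      case False
      then show ?thesis
        using y x0[of k] by (simp add: PiE_dflt_def)
    qed
  qed
  have "(\<Sum>x'\<in>?S. f (\<lambda>k. x k * x' k)) = (\<Sum>x'\<in>?S. f x')"
    by (rule sum.reindex_bij_witness[where i = "\<lambda>y k. x k * y k" and j = "\<lambda>y k. x k * y k"])
      (simp_all add: mult inv)
  then show ?thesis
    using finite_sign_vectors[of n] by (simp add: rademacher_prior_uniform integral_pmf_of_set)
qed

lemma rademacher_expectation_Suc: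
  "(\<integral>x. f x \<partial>rademacher_prior (Suc n)) =
     (\<integral>x. (f (x(n := -1)) + f (x(n := 1))) / 2 \<partial>rademacher_prior n)" for f :: "_ \<Rightarrow> real"
proof -
  have "rademacher_prior (Suc n) =
      pmf_of_set {-1, 1} \<bind> (\<lambda>y. map_pmf (\<lambda>x. x(n := y)) (rademacher_prior n))"
    unfolding rademacher_prior_def lessThan_Suc
    by (subst Pi_pmf_insert') (simp_all add: map_pmf_def)
  then have "(\<integral>x. f x \<partial>rademacher_prior (Suc n)) =
      (\<Sum>y\<in>{-1, 1}. (\<integral>x. f (x(n := y)) \<partial>rademacher_prior n) /\<^sub>R real (card {-1, 1 :: real}))"
    by (simp only:) (subst pmf_expectation_bind_pmf_of_set, auto simp: finite_set_rademacher_prior)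
  also have "\<dots> = (\<integral>x. (f (x(n := -1)) + f (x(n := 1))) / 2 \<partial>rademacher_prior n)"
    by (simp add: integrable_rademacher_prior field_simps)
  finally show ?thesis .
qed

lemma sign_sum_moment_0: "sign_sum_moment 0 m = 0 ^ m"
  by (simp add: sign_sum_moment_def)

lemma even_part_binomial:
  "((s - 1) ^ (2 * k) + (s + 1) ^ (2 * k)) / 2 = (\<Sum>j\<le>k. real (2 * k choose (2 * j)) * s ^ (2 * j))" for s :: real
proof -
  have "((s - 1) ^ (2 * k) + (s + 1) ^ (2 * k)) / 2 =
      (\<Sum>i\<le>2 * k. real (2 * k choose i) * s ^ i * (((- 1) ^ (2 * k - i) + 1) / 2))"
    using binomial_ring[of s "-1" "2 * k"] binomial_ring[of s 1 "2 * k"]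
    by (simp add: sum.distrib[symmetric] sum_divide_distrib algebra_simps)
  also have "\<dots> = (\<Sum>i\<in>(\<lambda>j. 2 * j) ` {..k}. real (2 * k choose i) * s ^ i * (((- 1) ^ (2 * k - i) + 1) / 2))"
  proof (rule sum.mono_neutral_right)
    show "\<forall>i\<in>{..2 * k} - (\<lambda>j. 2 * j) ` {..k}. real (2 * k choose i) * s ^ i * (((- 1) ^ (2 * k - i) + 1) / 2) = 0"
    proof
      fix i assume "i \<in> {..2 * k} - (\<lambda>j. 2 * j) ` {..k}"
      then have "odd i" "i \<le> 2 * k"
        by (auto elim!: evenE)
      then show "real (2 * k choose i) * s ^ i * (((- 1) ^ (2 * k - i) + 1) / 2) = 0"
        by simp
    qed
  qed auto
  also have "\<dots> = (\<Sum>j\<le>k. real (2 * k choose (2 * j)) * s ^ (2 * j))"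
  proof -
    have "(- 1 :: real) ^ (2 * k - 2 * j) = 1" for j
      by (simp flip: diff_mult_distrib2)
    then show ?thesis
      by (subst sum.reindex) (simp_all add: inj_on_def)
  qed
  finally show ?thesis .
qed

lemma sign_sum_moment_Suc:
  "sign_sum_moment (Suc n) (2 * k) = (\<Sum>j\<le>k. real (2 * k choose (2 * j)) * sign_sum_moment n (2 * j))"
proof -
  have "(\<Sum>i<Suc n. (x(n := y)) i) = (\<Sum>i<n. x i) + y" for x :: "nat \<Rightarrow> real" and y
    by simp
  then have "sign_sum_moment (Suc n) (2 * k) =
      (\<integral>x. (((\<Sum>i<n. x i) - 1) ^ (2 * k) + ((\<Sum>i<n. x i) + 1) ^ (2 * k)) / 2 \<partial>rademacher_prior n)"
    unfolding sign_sum_moment_def rademacher_expectation_Suc by simp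
  also have "\<dots> = (\<Sum>j\<le>k. real (2 * k choose (2 * j)) * sign_sum_moment n (2 * j))"
    unfolding even_part_binomial sign_sum_moment_def
    by (simp add: Bochner_Integration.integral_sum integrable_rademacher_prior)
  finally show ?thesis .
qed

lemma sign_sum_moment_odd:
  assumes "odd m"
  shows "sign_sum_moment n m = 0"
proof -
  have "(\<lambda>k. if k < n then -1 else 0) \<in> set_pmf (rademacher_prior n)"
    by (auto simp: set_rademacher_prior PiE_dflt_def)
  \<comment> \<open>multiplication by the vector with all entries \<open>-1\<close> is the symmetry \<open>S \<mapsto> -S\<close>\<close>
  from rademacher_expectation_mult[OF this, of "\<lambda>x. (\<Sum>k<n. x k) ^ m"]
  have "sign_sum_moment n m = (\<integral>x. (- (\<Sum>k<n. x k)) ^ m \<partial>rademacher_prior n)"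
    by (simp add: sign_sum_moment_def sum_negf)
  also have "\<dots> = - sign_sum_moment n m"
    using assms by (simp add: sign_sum_moment_def)
  finally show ?thesis by simp
qed

lemma two_power_fact_le_fact_double: "2 ^ i * fact i \<le> (fact (2 * i) :: real)"
proof (induction i)
  case (Suc i)
  have "2 ^ Suc i * fact (Suc i) = (2 * real i + 2) * (2 ^ i * fact i)"
    by (simp add: algebra_simps)
  also have "\<dots> \<le> (2 * real i + 2) * ((2 * real i + 1) * fact (2 * i))"
  proof (rule mult_left_mono)
    have "1 * fact (2 * i) \<le> (2 * real i + 1) * fact (2 * i)"
      by (rule mult_right_mono) simp_all
    then show "2 ^ i * fact i \<le> (2 * real i + 1) * fact (2 * i)"
      by (simp only: mult_1_left order_trans[OF Suc])
  qed simp
  also have "\<dots> = fact (2 * Suc i)"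
    by (simp add: algebra_simps)
  finally show ?case .
qed simp

text \<open>
  The bound is the Gaussian moment of variance \<open>n\<close>. It is stable under adding one sign,
  because the even moments of a sign, all equal to \<open>1\<close>, are at most those of a standard
  Gaussian, which is \<open>two_power_fact_le_fact_double\<close>.
\<close>

lemma sign_sum_moment_le_gaussian:
  "sign_sum_moment n (2 * k) \<le> real n ^ k * (fact (2 * k) / (2 ^ k * fact k))"
proof (induction n arbitrary: k)
  case 0
  show ?case by (cases k) (simp_all add: sign_sum_moment_0 del: fact_Suc)
next
  case (Suc n)
  have termwise: "real (2 * k choose (2 * j)) * (real n ^ j * (fact (2 * j) / (2 ^ j * fact j))) \<le>
      fact (2 * k) / (2 ^ k * fact k) * (real (k choose j) * real n ^ j)" if "j \<le> k" for j
  proof -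
    define i where "i = k - j"
    have "2 * k - 2 * j = 2 * i" "2 * j \<le> 2 * k"
      using that by (simp_all add: i_def)
    then have c: "real (2 * k choose (2 * j)) = fact (2 * k) / (fact (2 * j) * fact (2 * i))"
      using binomial_fact[of "2 * j" "2 * k", where 'a = real] by (simp only:)
    have c': "real (k choose j) = fact k / (fact j * fact i)"
      using binomial_fact[OF that, where 'a = real] by (simp only: i_def)
    have pow: "(2 :: real) ^ k = 2 ^ j * 2 ^ i"
      using that by (simp add: i_def flip: power_add)
    have "real (2 * k choose (2 * j)) * (fact (2 * j) / (2 ^ j * fact j)) = fact (2 * k) / (2 ^ j * fact j * fact (2 * i))"
      unfolding c by simp
    \<comment> \<open>the sign contributes moment \<open>1\<close>, at most \<open>(2i)! / (2\<^sup>i i!)\<close>\<close>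
    also have "\<dots> \<le> fact (2 * k) / (2 ^ j * fact j * (2 ^ i * fact i))"
      by (intro divide_left_mono mult_left_mono two_power_fact_le_fact_double) simp_all
    also have "\<dots> = fact (2 * k) / (2 ^ k * fact k) * real (k choose j)"
      unfolding c' pow by simp
    finally have "real (2 * k choose (2 * j)) * (fact (2 * j) / (2 ^ j * fact j)) * real n ^ j \<le>
        fact (2 * k) / (2 ^ k * fact k) * real (k choose j) * real n ^ j"
      by (rule mult_right_mono) simp
    then show ?thesis by (simp only: mult_ac)
  qed
  have "sign_sum_moment (Suc n) (2 * k) \<le>
      (\<Sum>j\<le>k. real (2 * k choose (2 * j)) * (real n ^ j * (fact (2 * j) / (2 ^ j * fact j))))"
    unfolding sign_sum_moment_Suc by (intro sum_mono mult_left_mono Suc.IH) simp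
  also have "\<dots> \<le> (\<Sum>j\<le>k. fact (2 * k) / (2 ^ k * fact k) * (real (k choose j) * real n ^ j))"
    by (intro sum_mono termwise) simp
  also have "\<dots> = fact (2 * k) / (2 ^ k * fact k) * (\<Sum>j\<le>k. real (k choose j) * real n ^ j)"
    by (rule sum_distrib_left[symmetric])
  also have "(\<Sum>j\<le>k. real (k choose j) * real n ^ j) = (real n + 1) ^ k"
    by (simp only: binomial_ring power_one mult_1_right)
  also have "fact (2 * k) / (2 ^ k * fact k) * (real n + 1) ^ k =
      real (Suc n) ^ k * (fact (2 * k) / (2 ^ k * fact k))"
    by (simp only: of_nat_Suc add.commute mult.commute)
  finally show ?case .
qed

text \<open>
  The left-hand side counts the words of length \<open>2k\<close> over \<open>n\<close> letters in which \<open>k\<close> letters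
  occur exactly twice; each such word contributes \<open>1\<close> to the moment. The induction adds a
  letter that occurs either twice or not at all, which is Pascal's rule.
\<close>

lemma sign_sum_moment_ge_pairings:
  "real (n choose k) * (fact (2 * k) / 2 ^ k) \<le> sign_sum_moment n (2 * k)"
proof (induction n arbitrary: k)
  case 0
  show ?case by (cases k) (simp_all add: sign_sum_moment_0 del: fact_Suc)
next
  case (Suc n)
  have nonneg: "0 \<le> sign_sum_moment n (2 * j)" for j
    by (rule order_trans[OF _ Suc.IH]) simp
  show ?case
  proof (cases k)
    case 0
    then show ?thesis by (simp add: sign_sum_moment_def)
  next
    case [simp]: (Suc l)
    have choose2: "real (2 * k choose (2 * l)) * (fact (2 * l) / 2 ^ l) = fact (2 * k) / 2 ^ k"
    proof -
      have "real (2 * k choose (2 * l)) = fact (2 * k) / (fact (2 * l) * 2)"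
        using binomial_fact[of "2 * l" "2 * k", where 'a = real] by (simp del: fact_Suc)
      then show ?thesis by (simp del: fact_Suc)
    qed
    have "real (Suc n choose k) * (fact (2 * k) / 2 ^ k) =
        real (n choose l) * (fact (2 * k) / 2 ^ k) + real (n choose k) * (fact (2 * k) / 2 ^ k)"
      by (simp only: Suc binomial_Suc_Suc of_nat_add distrib_right)
    also have "\<dots> = real (2 * k choose (2 * l)) * (real (n choose l) * (fact (2 * l) / 2 ^ l)) +
        real (n choose k) * (fact (2 * k) / 2 ^ k)"
      by (simp only: mult.left_commute[of "real (2 * k choose (2 * l))"] choose2)
    \<comment> \<open>from here on only the new letter occurring twice (\<open>j = l\<close>) or never (\<open>j = k\<close>) is kept\<close>
    also have "\<dots> \<le> real (2 * k choose (2 * l)) * sign_sum_moment n (2 * l) +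
        real (2 * k choose (2 * k)) * sign_sum_moment n (2 * k)"
      using Suc.IH[of l] Suc.IH[of k] by (intro add_mono mult_left_mono) simp_all
    also have "\<dots> = (\<Sum>j\<in>{l, k}. real (2 * k choose (2 * j)) * sign_sum_moment n (2 * j))"
      by simp
    also have "\<dots> \<le> (\<Sum>j\<le>k. real (2 * k choose (2 * j)) * sign_sum_moment n (2 * j))"
      by (intro sum_mono2) (auto simp: nonneg)
    also have "\<dots> = sign_sum_moment (Suc n) (2 * k)"
      by (rule sign_sum_moment_Suc[symmetric])
    finally show ?thesis .
  qed
qed

lemma sign_sum_moment_nonneg: "0 \<le> sign_sum_moment n m"
proof (cases "even m")
  case True
  then show ?thesis
    by (auto simp: sign_sum_moment_def zero_le_even_power)
qed (simp add: sign_sum_moment_odd)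

lemma fact_double_le: "fact (2 * k) \<le> real k ^ k * (2 ^ k * fact k)"
proof -
  have half: "2 * k - k = k" by simp
  have "fact k dvd (fact (2 * k) :: nat)"
    by (rule fact_dvd) simp
  define q :: nat where "q = fact (2 * k) div fact k"
  have "(fact (2 * k) :: nat) = q * fact k"
    unfolding q_def by (rule dvd_div_mult_self[symmetric]) fact
  then have "real (fact (2 * k)) = real (q * fact k)"
    by (rule arg_cong)
  then have eq: "(fact (2 * k) :: real) = real q * fact k"
    by (simp only: of_nat_fact of_nat_mult)
  have "q \<le> (2 * k) ^ k"
    unfolding q_def by (rule fact_div_fact_le_pow[of k "2 * k", unfolded half]) simp
  then have "real q \<le> real ((2 * k) ^ k)"
    by (simp only: of_nat_le_iff)
  then have "real q \<le> real k ^ k * 2 ^ k"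
    by (simp only: of_nat_mult of_nat_power of_nat_numeral power_mult_distrib mult.commute)
  then have "real q * fact k \<le> real k ^ k * 2 ^ k * fact k"
    by (rule mult_right_mono) simp
  then show ?thesis
    unfolding eq by (simp only: mult.assoc)
qed

lemma sign_sum_moment_upper: "sign_sum_moment n (2 * k) \<le> (real n * real k) ^ k"
proof -
  have pos: "0 < 2 ^ k * (fact k :: real)"
    by simp
  have "fact (2 * k) / (2 ^ k * fact k) \<le> real k ^ k"
    using fact_double_le[of k] by (simp only: pos_divide_le_eq[OF pos])
  then have "real n ^ k * (fact (2 * k) / (2 ^ k * fact k)) \<le> real n ^ k * real k ^ k"
    by (rule mult_left_mono) simp
  also have "\<dots> = (real n * real k) ^ k"
    by (rule power_mult_distrib[symmetric])
  finally show ?thesis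
    by (rule order_trans[OF sign_sum_moment_le_gaussian])
qed

text \<open>
  A single term of the exponential series at \<open>m\<close>.
\<close>

lemma power_self_le_fact_exp: "real m ^ m \<le> fact m * exp (real m)"
proof -
  have "real m ^ m /\<^sub>R fact m \<le> (\<Sum>i. real m ^ i /\<^sub>R fact i)"
    using sum_le_suminf[OF summable_exp_generic[of "real m"], of "{m}"] by simp
  then have "real m ^ m / fact m \<le> exp (real m)"
    by (simp add: exp_def divide_inverse mult.commute)
  then show ?thesis by (simp add: divide_le_eq mult.commute)
qed

text \<open>
  From the count of paired words, with \<open>(n/k)\<^sup>k\<close> for the binomial coefficient and
  \<open>(2k/e)\<^bsup>2k\<^esup>\<close> for the factorial.
\<close>

lemma sign_sum_moment_lower:
  assumes "k \<le> n"
  shows "(2 * real n * real k / exp 2) ^ k \<le> sign_sum_moment n (2 * k)"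
proof (cases "k = 0")
  case True
  then show ?thesis by (simp add: sign_sum_moment_def)
next
  case False
  have "(2 * real n * real k / exp 2) ^ k = (real n / real k) ^ k * (real (2 * k) ^ (2 * k) / exp (real (2 * k)) / 2 ^ k)"
    using False
    by (simp add: power_mult power_divide power_mult_distrib exp_of_nat_mult[symmetric] field_simps power2_eq_square)
  also have "\<dots> \<le> real (n choose k) * (fact (2 * k) / 2 ^ k)"
    using power_self_le_fact_exp[of "2 * k"] binomial_ge_n_over_k_pow_k[OF assms, where 'a = real]
    by (intro mult_mono divide_right_mono) (simp_all add: divide_le_eq)
  also have "\<dots> \<le> sign_sum_moment n (2 * k)"
    by (rule sign_sum_moment_ge_pairings)
  finally show ?thesis .
qed

section \<open>The low-degree norm of the spiked tensor model\<close>

text \<open>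
  Tensor powers turn the inner product into its \<open>p\<close>-th power: expand the product of \<open>p\<close>
  equal sums.
\<close>

lemma inner_tensor_power:
  "(\<Sum>i\<in>tensor_index p n. tensor_power p x i * tensor_power p y i) = (\<Sum>k<n. x k * y k) ^ p"
proof -
  have "(\<Sum>k<n. x k * y k) ^ p = (\<Prod>j<p. \<Sum>k<n. x k * y k)"
    by simp
  also have "\<dots> = (\<Sum>i\<in>tensor_index p n. \<Prod>j<p. x (i j) * y (i j))"
    unfolding tensor_index_def by (rule prod_sum_PiE) auto
  finally show ?thesis
    by (simp add: tensor_power_def prod.distrib)
qed

lemma planted_measure_eq_additive_gaussian:
  "planted_measure p n lam =
     additive_gaussian_model (tensor_index p n) (rademacher_prior n) (\<lambda>x i. lam * tensor_power p x i)"
  by (simp add: planted_measure_def additive_gaussian_model_def null_measure_def)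

lemma low_degree_norm_sq:
  "(low_degree_norm p n lam D)\<^sup>2 = (\<Sum>d\<le>D. (lam\<^sup>2) ^ d / fact d * sign_sum_moment n (p * d))"
proof -
  have fin: "finite (tensor_index p n)"
    unfolding tensor_index_def by (rule finite_PiE) auto
  have "(low_degree_norm p n lam D)\<^sup>2 = (\<integral>x. (\<integral>x'. (\<Sum>d\<le>D.
      (\<Sum>i\<in>tensor_index p n. lam * tensor_power p x i * (lam * tensor_power p x' i)) ^ d / fact d)
      \<partial>rademacher_prior n) \<partial>rademacher_prior n)"
    unfolding low_degree_norm_def low_degree_likelihood_ratio_def likelihood_ratio_def
      planted_measure_eq_additive_gaussian null_measure_def
    by (rule additive_gaussian_low_degree_norm[OF fin finite_set_rademacher_prior])
  also have "\<dots> = (\<integral>x. (\<integral>x'. (\<Sum>d\<le>D. (lam\<^sup>2) ^ d / fact d * (\<Sum>k<n. x k * x' k) ^ (p * d))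
      \<partial>rademacher_prior n) \<partial>rademacher_prior n)"
  proof -
    have "(\<Sum>i\<in>tensor_index p n. lam * tensor_power p x i * (lam * tensor_power p x' i)) =
        lam\<^sup>2 * (\<Sum>k<n. x k * x' k) ^ p" for x x'
      by (simp add: sum_distrib_left mult_ac power2_eq_square flip: inner_tensor_power)
    then show ?thesis
      by (simp add: power_mult_distrib power_mult)
  qed
  also have "\<dots> = (\<integral>x. (\<Sum>d\<le>D. (lam\<^sup>2) ^ d / fact d * (\<integral>x'. (\<Sum>k<n. x k * x' k) ^ (p * d)
      \<partial>rademacher_prior n)) \<partial>rademacher_prior n)"
    by (simp add: Bochner_Integration.integral_sum integrable_rademacher_prior)
  also have "\<dots> = (\<integral>x. (\<Sum>d\<le>D. (lam\<^sup>2) ^ d / fact d * sign_sum_moment n (p * d)) \<partial>rademacher_prior n)"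
  proof (rule integral_cong_AE)
    show "AE x in rademacher_prior n. (\<Sum>d\<le>D. (lam\<^sup>2) ^ d / fact d *
        (\<integral>x'. (\<Sum>k<n. x k * x' k) ^ (p * d) \<partial>rademacher_prior n)) =
        (\<Sum>d\<le>D. (lam\<^sup>2) ^ d / fact d * sign_sum_moment n (p * d))"
      using rademacher_expectation_mult[where f = "\<lambda>z. (\<Sum>k<n. z k) ^ (p * _)"]
      by (auto simp: AE_measure_pmf_iff sign_sum_moment_def)
  qed simp_all
  finally show ?thesis by simp
qed

section \<open>The threshold\<close>

lemma powr_square: "(x powr y)\<^sup>2 = x powr (2 * y)" for x y :: real
  by (simp only: power2_eq_square mult_2 powr_add)

lemma lower_const_sq: "(lower_const p)\<^sup>2 = 1 / 2 * real p powr (- real p / 2 - 1)"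
proof -
  have "2 * (- real p / 4 - 1 / 2) = - real p / 2 - 1" by simp
  then show ?thesis
    unfolding lower_const_def by (simp only: power_mult_distrib powr_square) (simp add: power_divide)
qed

lemma upper_const_sq: "(upper_const p)\<^sup>2 = 2 * exp (real p) * real p powr (- real p / 2)"
proof -
  have "2 * (- real p / 4) = - real p / 2" by simp
  then show ?thesis
    unfolding upper_const_def
    by (simp only: power_mult_distrib powr_square) (simp flip: exp_double)
qed

lemma scaling_sq:
  "(c * real n powr (- real p / 4) * real D powr ((2 - real p) / 4))\<^sup>2 =
     c\<^sup>2 * real n powr (- (real p / 2)) * real D powr (1 - real p / 2)"
proof -
  have "2 * (- real p / 4) = - (real p / 2)" "2 * ((2 - real p) / 4) = 1 - real p / 2"
    by simp_all
  then show ?thesis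
    by (simp only: power_mult_distrib powr_square)
qed

lemma low_degree_norm_nonneg: "0 \<le> low_degree_norm p n lam D"
  by (simp add: low_degree_norm_def L2_norm_def L2_inner_def)

text \<open>
  Writes the moment bounds, whose exponent is \<open>k = p d / 2\<close>, as \<open>d\<close>-th powers, so that a whole
  term of the norm formula becomes a \<open>d\<close>-th power over \<open>d!\<close>.
\<close>

lemma power_half_eq:
  fixes w :: real
  assumes "0 < w" and "p * d = 2 * k"
  shows "w ^ k = (w powr (real p / 2)) ^ d"
proof -
  have "real p * real d = 2 * real k"
    using assms(2) by (metis of_nat_mult of_nat_numeral)
  then have "real k = real p / 2 * real d" by simp
  then have "w powr real k = (w powr (real p / 2)) powr real d"
    by (simp only: powr_powr)
  then show ?thesis
    using assms(1) by (simp add: powr_realpow)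
qed

text \<open>
  With \<open>t = p/2\<close>, the squared signal strength \<open>a\<close> times \<open>(n p d)\<^sup>t\<close> is at most
  \<open>D\<^bsup>1-t\<^esup> d\<^sup>t / (2 p) \<le> d / 4\<close>: powers of \<open>n\<close> and \<open>p\<close> cancel, and \<open>D\<^bsup>1-t\<^esup>\<close> may be replaced by
  \<open>d\<^bsup>1-t\<^esup>\<close> because the exponent is not positive. The remaining \<open>d\<^sup>d / d!\<close> costs \<open>e\<^sup>d\<close>.
\<close>

lemma low_degree_term_upper:
  assumes p: "p \<ge> 2" and n: "n > 0" and d: "d \<le> D" and a: "0 \<le> a"
    and a_le: "a \<le> (lower_const p)\<^sup>2 * real n powr (- (real p / 2)) * real D powr (1 - real p / 2)"
  shows "a ^ d / fact d * sign_sum_moment n (p * d) \<le> (exp 1 / 4) ^ d"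
proof -
  define t where "t = real p / 2"
  have t: "1 \<le> t" using p by (simp add: t_def)
  consider "d = 0" | "odd (p * d)" | k where "d > 0" "p * d = 2 * k"
    by (metis evenE neq0_conv)
  then show ?thesis
  proof cases
    case 1
    then show ?thesis by (simp add: sign_sum_moment_def)
  next
    case 2
    then show ?thesis by (simp add: sign_sum_moment_odd)
  next
    case 3
    define w where "w = real n * (real p * real d)"
    have w: "0 < w" using n p 3 by (simp add: w_def)
    have "real p * real d = 2 * real k"
      using 3(2) by (metis of_nat_mult of_nat_numeral)
    then have "real n * real k \<le> w"
      by (auto simp: w_def intro!: mult_left_mono)
    then have "sign_sum_moment n (p * d) \<le> w ^ k"
      using sign_sum_moment_upper[of n k] power_mono[of "real n * real k" w k] 3(2) by simp
    also have "\<dots> = (w powr t) ^ d"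
      unfolding t_def by (rule power_half_eq[OF w 3(2)])
    finally have "a ^ d / fact d * sign_sum_moment n (p * d) \<le> a ^ d / fact d * (w powr t) ^ d"
      using a by (intro mult_left_mono) simp_all
    also have "\<dots> = (a * w powr t) ^ d / fact d"
      by (simp add: power_mult_distrib)
    also have "\<dots> \<le> (real d / 4) ^ d / fact d"
    proof (intro divide_right_mono power_mono)
      have w_t: "w powr t = real n powr t * (real p powr t * real d powr t)"
        by (simp add: w_def powr_mult)
      have "a * w powr t \<le> 1 / 2 * real p powr (- t - 1) * real n powr (- t) * real D powr (1 - t) * w powr t"
        using a_le by (intro mult_right_mono) (simp_all add: lower_const_sq t_def)
      also have "\<dots> \<le> 1 / 2 * real p powr (- t - 1) * real n powr (- t) * real d powr (1 - t) * w powr t"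
        using t d 3(1) by (intro mult_right_mono mult_left_mono powr_mono2') simp_all
      also have "\<dots> = 1 / 2 * (real p powr (- t - 1) * real p powr t) * (real n powr (- t) * real n powr t) *
          (real d powr (1 - t) * real d powr t)"
        by (simp only: w_t mult_ac)
      also have "\<dots> = 1 / 2 * (1 / real p) * real d"
        using n p 3(1) by (simp add: powr_minus_divide flip: powr_add)
      also have "\<dots> \<le> 1 / 2 * (1 / 2) * real d"
        using p by (intro mult_right_mono mult_left_mono divide_left_mono) simp_all
      finally show "a * w powr t \<le> real d / 4" by simp
    qed (use a in simp_all)
    also have "\<dots> = real d ^ d / fact d * (1 / 4) ^ d"
      by (simp add: power_divide)
    also have "\<dots> \<le> exp (real d) * (1 / 4) ^ d"
      using power_self_le_fact_exp[of d]
      by (intro mult_right_mono) (simp_all add: divide_le_eq mult.commute)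
    also have "\<dots> = (exp 1 / 4) ^ d"
      using exp_of_nat_mult[of d "1 :: real"] by (simp add: power_divide)
    finally show ?thesis .
  qed
qed

lemma low_degree_norm_bounded:
  assumes p: "p \<ge> 2" and n: "n > 0" and lam: "lam > 0"
    and lam_le: "lam \<le> lower_const p * real n powr (- real p / 4) * real D powr ((2 - real p) / 4)"
  shows "low_degree_norm p n lam D \<le> 2"
proof -
  have "lam\<^sup>2 \<le> (lower_const p * real n powr (- real p / 4) * real D powr ((2 - real p) / 4))\<^sup>2"
    using lam lam_le by (intro power_mono) simp_all
  then have a_le: "lam\<^sup>2 \<le> (lower_const p)\<^sup>2 * real n powr (- (real p / 2)) * real D powr (1 - real p / 2)"
    by (simp only: scaling_sq)
  have "(low_degree_norm p n lam D)\<^sup>2 \<le> (\<Sum>d\<le>D. (exp 1 / 4) ^ d)"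
    unfolding low_degree_norm_sq
    by (intro sum_mono low_degree_term_upper[OF p n _ _ a_le]) simp_all
  also have "\<dots> \<le> (\<Sum>d\<le>D. (3 / 4) ^ d)"
    using exp_le by (intro sum_mono power_mono) simp_all
  also have "\<dots> \<le> (\<Sum>d. (3 / 4) ^ d)"
    by (intro sum_le_suminf summable_geometric) simp_all
  also have "\<dots> = 2\<^sup>2"
    by (subst suminf_geometric) simp_all
  finally show ?thesis
    by (rule power2_le_imp_le) simp
qed

text \<open>
  Rounding \<open>D\<close> down to an even degree \<open>d\<close> costs only a constant factor, since
  \<open>(1 + 1/d)\<^sup>d \<le> e\<close>.
\<close>

lemma ratio_power_ge:
  assumes "0 < d" "0 < D" "D \<le> d + 1"
  shows "exp (- 1) \<le> (real d / real D) ^ d"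
proof -
  have "real D / real d \<le> (real d + 1) / real d"
    using assms by (intro divide_right_mono) simp_all
  also have "\<dots> = 1 + 1 / real d"
    using assms by (simp add: field_simps)
  also have "\<dots> \<le> exp (1 / real d)"
    by (rule exp_ge_add_one_self)
  finally have "(real D / real d) ^ d \<le> exp (1 / real d) ^ d"
    by (rule power_mono) simp
  also have "\<dots> = exp 1"
    using assms by (simp flip: exp_of_nat_mult)
  finally have "inverse (exp 1) \<le> inverse ((real D / real d) ^ d)"
    using assms by (intro le_imp_inverse_le) simp_all
  then show ?thesis
    by (simp add: exp_minus power_inverse[symmetric])
qed

text \<open>
  All terms of the norm formula are nonnegative, so one suffices: that of degree
  \<open>d = 2 \<lfloor>D/2\<rfloor>\<close>, even so that the moment of order \<open>p d\<close> does not vanish. The factor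
  \<open>e\<^bsup>p/2\<^esup>\<close> in the constant cancels the loss \<open>e\<^bsup>-2k\<^esup>\<close> in the moment bound, and the factor
  \<open>sqrt 2\<close> leaves \<open>2\<^sup>d\<close>. The stated bound is linear in \<open>D\<close>, which already diverges.
\<close>

lemma low_degree_norm_sq_ge:
  assumes p: "p \<ge> 2" and n: "n > 0" and D: "D \<ge> 2" "real D \<le> 2 / real p * real n"
    and lam_ge: "lam \<ge> upper_const p * real n powr (- real p / 4) * real D powr ((2 - real p) / 4)"
  shows "real D / 2 * exp (1 - real p / 2) \<le> (low_degree_norm p n lam D)\<^sup>2"
proof -
  define t where "t = real p / 2"
  have t: "1 \<le> t" using p by (simp add: t_def)
  define a where "a = lam\<^sup>2"
  have "0 \<le> upper_const p * real n powr (- real p / 4) * real D powr ((2 - real p) / 4)"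
    by (simp add: upper_const_def)
  then have "(upper_const p * real n powr (- real p / 4) * real D powr ((2 - real p) / 4))\<^sup>2 \<le> a"
    unfolding a_def using lam_ge by (intro power_mono)
  then have a_ge: "2 * exp (real p) * real p powr (- t) * real n powr (- t) * real D powr (1 - t) \<le> a"
    by (simp only: scaling_sq upper_const_sq t_def) simp
  define k where "k = p * (D div 2)"
  define d where "d = 2 * (D div 2)"
  have d: "0 < d" "d \<le> D" "D \<le> d + 1"
    using D(1) by (simp_all add: d_def)
  have pd: "p * d = 2 * k"
    by (simp add: d_def k_def)
  have pd_real: "real p * real d = 2 * real k"
    using pd by (metis of_nat_mult of_nat_numeral)
  have "real p * real d \<le> real p * real D"
    using d by (intro mult_left_mono) simp_all
  also have "\<dots> \<le> 2 * real n"
    using D(2) p by (simp add: field_simps)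
  finally have k_le: "k \<le> n"
    using pd_real by simp
  define w where "w = real n * (real p * real d) * exp (- 2)"
  have w: "0 < w" using n p d by (simp add: w_def)
  have "2 ^ d * exp (1 - t) \<le> 2 ^ d * ((real d / real D) ^ d) powr (t - 1)"
  proof (rule mult_left_mono)
    have "exp (1 - t) = exp (- 1) powr (t - 1)"
      by (simp add: powr_def)
    also have "\<dots> \<le> ((real d / real D) ^ d) powr (t - 1)"
      using t d by (intro powr_mono2 ratio_power_ge) simp_all
    finally show "exp (1 - t) \<le> \<dots>" .
  qed simp
  also have "\<dots> \<le> real d ^ d / fact d * (2 ^ d * ((real d / real D) ^ d) powr (t - 1))"
  proof -
    have "1 \<le> real d ^ d / fact d"
      using fact_le_power[of d, where 'a = real] by (simp add: le_divide_eq)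
    then show ?thesis
      using mult_right_mono[of 1 "real d ^ d / fact d" "2 ^ d * ((real d / real D) ^ d) powr (t - 1)"] by simp
  qed
  also have "\<dots> = (2 * (real d powr t * real D powr (1 - t))) ^ d / fact d"
  proof -
    have "real d powr t * real D powr (1 - t) = real d * (real d / real D) powr (t - 1)"
      using d by (simp add: powr_divide powr_diff)
    moreover have "((real d / real D) ^ d) powr (t - 1) = ((real d / real D) powr (t - 1)) ^ d"
      using d by (simp add: powr_power powr_powr mult.commute flip: powr_realpow)
    ultimately show ?thesis
      by (simp add: power_mult_distrib)
  qed
  also have "\<dots> \<le> (a * w powr t) ^ d / fact d"
  proof (intro divide_right_mono power_mono)
    have "w powr t = real n powr t * (real p powr t * real d powr t) * exp (- real p)"
      by (simp add: w_def powr_mult) (simp add: powr_def t_def)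
    then have "2 * exp (real p) * real p powr (- t) * real n powr (- t) * real D powr (1 - t) * w powr t =
        2 * (exp (real p) * exp (- real p)) * (real p powr (- t) * real p powr t) *
        (real n powr (- t) * real n powr t) * (real d powr t * real D powr (1 - t))"
      by (simp only: mult_ac)
    also have "\<dots> = 2 * (real d powr t * real D powr (1 - t))"
      using n p by (simp flip: powr_add exp_add)
    finally have "2 * (real d powr t * real D powr (1 - t)) =
        2 * exp (real p) * real p powr (- t) * real n powr (- t) * real D powr (1 - t) * w powr t" ..
    also have "\<dots> \<le> a * w powr t"
      using a_ge by (rule mult_right_mono) simp
    finally show "2 * (real d powr t * real D powr (1 - t)) \<le> a * w powr t" .
  qed simp_all
  also have "\<dots> = a ^ d / fact d * w ^ k"
    unfolding power_half_eq[OF w pd] t_def by (simp add: power_mult_distrib)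
  also have "\<dots> \<le> a ^ d / fact d * sign_sum_moment n (p * d)"
  proof (rule mult_left_mono)
    have "w = 2 * real n * real k / exp 2"
      by (simp add: w_def pd_real exp_minus divide_inverse)
    then show "w ^ k \<le> sign_sum_moment n (p * d)"
      using sign_sum_moment_lower[OF k_le] pd by simp
  qed (simp add: a_def)
  also have "\<dots> \<le> (\<Sum>d\<le>D. a ^ d / fact d * sign_sum_moment n (p * d))"
    using d by (intro member_le_sum) (simp_all add: a_def sign_sum_moment_nonneg)
  also have "\<dots> = (low_degree_norm p n lam D)\<^sup>2"
    by (simp add: low_degree_norm_sq a_def)
  finally have main: "2 ^ d * exp (1 - t) \<le> (low_degree_norm p n lam D)\<^sup>2" .
  have "D \<le> 2 ^ D"
    by (rule less_imp_le) (rule less_exp)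
  also have "\<dots> \<le> 2 ^ (d + 1)"
    using d by (intro power_increasing) simp_all
  finally have "real D \<le> real (2 ^ (d + 1))"
    by (simp only: of_nat_le_iff)
  then have "real D / 2 * exp (1 - t) \<le> 2 ^ d * exp (1 - t)"
    by (intro mult_right_mono) simp_all
  also note main
  finally show ?thesis
    by (simp only: t_def)
qed

lemma lower_const_pos: "p > 0 \<Longrightarrow> 0 < lower_const p"
  by (simp add: lower_const_def)

lemma lower_const_less_upper_const:
  assumes "p > 0"
  shows "lower_const p < upper_const p"
proof -
  have "lower_const p = 1 / sqrt 2 * (real p powr (- real p / 4) * real p powr (- 1 / 2))"
    by (simp add: lower_const_def flip: powr_add)
  also have "\<dots> \<le> 1 / sqrt 2 * (real p powr (- real p / 4) * 1)"
  proof (intro mult_left_mono)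
    show "real p powr (- 1 / 2) \<le> 1"
      using assms powr_mono2'[of "- 1 / 2" 1 "real p"] by simp
  qed simp_all
  also have "\<dots> < sqrt 2 * real p powr (- real p / 4)"
    using assms by (simp add: divide_less_eq)
  also have "\<dots> \<le> sqrt 2 * exp (real p / 2) * real p powr (- real p / 4)"
    by (intro mult_right_mono) simp_all
  finally show ?thesis
    by (simp add: upper_const_def)
qed

theorem theorem3p3:
  fixes p :: nat
  assumes "p \<ge> 2"
  shows "0 < lower_const p \<and> lower_const p < upper_const p \<and>
    (\<forall>(D :: nat \<Rightarrow> nat) (lam :: nat \<Rightarrow> real).
      (\<forall>n. D n > 0) \<and> (\<forall>n. lam n > 0) \<longrightarrow>
        ((\<forall>\<^sub>F n in sequentially.
            lam n \<le> lower_const p * real n powr (- real p / 4)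
                      * real (D n) powr ((2 - real p) / 4))
          \<longrightarrow> (\<lambda>n. low_degree_norm p n (lam n) (D n)) \<in> O(\<lambda>_. 1)) \<and>
        ((\<forall>\<^sub>F n in sequentially.
            lam n \<ge> upper_const p * real n powr (- real p / 4)
                      * real (D n) powr ((2 - real p) / 4)
            \<and> real (D n) \<le> 2 / real p * real n) \<and>
         filterlim D at_top sequentially
          \<longrightarrow> filterlim (\<lambda>n. low_degree_norm p n (lam n) (D n)) at_top sequentially))"
proof (intro conjI allI impI)
  show "0 < lower_const p" "lower_const p < upper_const p"
    using assms by (simp_all add: lower_const_pos lower_const_less_upper_const)
next
  fix D :: "nat \<Rightarrow> nat" and lam :: "nat \<Rightarrow> real"
  assume pos: "(\<forall>n. D n > 0) \<and> (\<forall>n. lam n > 0)"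
    and small: "\<forall>\<^sub>F n in sequentially.
      lam n \<le> lower_const p * real n powr (- real p / 4) * real (D n) powr ((2 - real p) / 4)"
  have "\<forall>\<^sub>F n in sequentially. norm (low_degree_norm p n (lam n) (D n)) \<le> 2 * norm (1 :: real)"
    using small eventually_gt_at_top[of 0]
  proof eventually_elim
    case (elim n)
    then show ?case
      using low_degree_norm_bounded[of p n "lam n" "D n"] low_degree_norm_nonneg[of p n "lam n" "D n"] pos assms
      by simp
  qed
  then show "(\<lambda>n. low_degree_norm p n (lam n) (D n)) \<in> O(\<lambda>_. 1)"
    by (rule bigoI)
next
  fix D :: "nat \<Rightarrow> nat" and lam :: "nat \<Rightarrow> real"
  assume *: "(\<forall>\<^sub>F n in sequentially.
      lam n \<ge> upper_const p * real n powr (- real p / 4) * real (D n) powr ((2 - real p) / 4)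
      \<and> real (D n) \<le> 2 / real p * real n) \<and> filterlim D at_top sequentially"
  define c where "c = exp (1 - real p / 2) / 2"
  have "filterlim (\<lambda>n. real (D n)) at_top sequentially"
    using filterlim_compose[OF filterlim_real_sequentially] * by blast
  then have "filterlim (\<lambda>n. c * real (D n)) at_top sequentially"
    by (intro filterlim_tendsto_pos_mult_at_top[OF tendsto_const]) (simp_all add: c_def)
  then have lim: "filterlim (\<lambda>n. sqrt (c * real (D n))) at_top sequentially"
    by (rule filterlim_compose[OF sqrt_at_top])
  have "\<forall>\<^sub>F n in sequentially. D n \<ge> 2"
    using * by (simp add: filterlim_at_top)
  then have "\<forall>\<^sub>F n in sequentially. sqrt (c * real (D n)) \<le> low_degree_norm p n (lam n) (D n)"
    using *[THEN conjunct1] eventually_gt_at_top[of 0]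
  proof eventually_elim
    case (elim n)
    then have "c * real (D n) \<le> (low_degree_norm p n (lam n) (D n))\<^sup>2"
      using low_degree_norm_sq_ge[of p n "D n" "lam n"] assms by (simp add: c_def mult.commute)
    then show ?case
      by (rule real_le_lsqrt[OF low_degree_norm_nonneg])
  qed
  with lim show "filterlim (\<lambda>n. low_degree_norm p n (lam n) (D n)) at_top sequentially"
    by (rule filterlim_at_top_mono)
qed

end
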